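(* Consider the bi-orthogonal polynomial system on the unit circle for the regular semi-classical weight with finite singularities $0,s,t,1$ (distinct) and exponents $\rho_0,\rho_s,\rho_t,\rho_1$, and let $f_n,g_n,\omega_n,\varpi_n$ be defined from its spectral coefficients as in the context, i.e. $$sf_n=\frac{\Theta_n(s)}{\Theta_n(1)},\qquad tg_n=\frac{\Theta_n(t)}{\Theta_n(1)},$$ $$\Omega_n(z)=ne_3-\tfrac12m_3+(\omega_n-\tfrac12m_2)z+(\varpi_n+\tfrac12m_1)z^2+(1+\tfrac12m_0)z^3 .$$ Then the following system of coupled first-order recurrence relations in $n$ for $\{f_n,g_n,\omega_n,\varpi_n\}_{n=0}^\infty$ completely characterises the bi-orthogonal polynomial system, in the sense that these variables satisfy the relations and initial conditions below and are recursively determined by them: $$sf_nf_{n+1}=\frac{\left[\omega_n+s\varpi_n+(1+m_0)s^2+(n-\rho_0)t+\rho_s(s-t)(1-s)\right]\left[\omega_n+s\varpi_n+(1+m_0)s^2+(n-\rho_0)t\right]}{\left[\omega_n+\varpi_n+1+m_0+(n-\rho_0)st+\rho_1(1-s)(t-1)\right]\left[\omega_n+\varpi_n+1+m_0+(n-\rho_0)st\right]},$$ $$tg_ng_{n+1}=\frac{\left[\omega_n+t\varpi_n+(1+m_0)t^2+(n-\rho_0)s+\rho_t(t-s)(1-t)\right]\left[\omega_n+t\varpi_n+(1+m_0)t^2+(n-\rho_0)s\right]}{\left[\omega_n+\varpi_n+1+m_0+(n-\rho_0)st+\rho_1(1-s)(t-1)\right]\left[\omega_n+\varpi_n+1+m_0+(n-\rho_0)st\right]}$$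 for $n\ge0$, and $$\omega_n+\omega_{n-1}=m_2-(n-1)(s+t+st)+(n-\rho_0)\frac{s^2-t^2+(1-s^2)tg_n-(1-t^2)sf_n}{t-s+(1-t)f_n-(1-s)g_n}+(n+1+m_0)st\,\frac{t-s+(1-t)f_n-(1-s)g_n}{t-s+(1-t)sf_n-(1-s)tg_n},$$ $$\varpi_n+\varpi_{n-1}=-m_1+(n-1)(1+s+t)+(n-\rho_0)\frac{t-s+(1-t)sf_n-(1-s)tg_n}{t-s+(1-t)f_n-(1-s)g_n}+(n+1+m_0)\frac{s^2-t^2+(1-s^2)tg_n-(1-t^2)sf_n}{t-s+(1-t)sf_n-(1-s)tg_n}$$ for $n\ge1$, subject to the initial conditions $$f_0=\frac{(1+m_0)sw_{-1}-\left[\rho_0s(t+1)+\rho_1st+\rho_st+\rho_ts\right]w_0-(1-\rho_0)stw_1}{(1+m_0)w_{-1}-\left[\rho_0(s+t)+\rho_1st+\rho_st+\rho_ts\right]w_0-(1-\rho_0)stw_1},$$ $$g_0=\frac{(1+m_0)tw_{-1}-\left[\rho_0t(s+1)+\rho_1st+\rho_st+\rho_ts\right]w_0-(1-\rho_0)stw_1}{(1+m_0)w_{-1}-\left[\rho_0(s+t)+\rho_1st+\rho_st+\rho_ts\right]w_0-(1-\rho_0)stw_1},$$ $$\omega_0=(1-\rho_0)st\frac{w_1}{w_0}+\rho_0st\frac{w_0}{w_{-1}}+\rho_0(s+t+st)+\rho_1st+\rho_st+\rho_ts,$$ $$\varpi_0=-(1+m_0)\frac{w_{-1}}{w_0}-(1-\rho_0)st\frac{w_1}{w_{-1}}-\left[\rho_0(s+t+st)+\rho_1st+\rho_st+\rho_ts\right]\frac{w_0}{w_{-1}}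 .$$
   Context: **Bi-orthogonal system.** $\mathbb T$ is the unit circle and $w$ a complex weight on it, $w_k=\int_{\mathbb T}\frac{d\zeta}{2\pi i\zeta}w(\zeta)\zeta^{-k}$, $I_n=\det[w_{i-j}]_{i,j=0}^{n-1}$, $I_0=1$; it is assumed that $I_n\ne0$ for all $n$. $\phi_n,\bar\phi_n$ are polynomials of degree $n$ with the same leading coefficient $\kappa_n$ (and $\bar\phi_n$ is not in general the complex conjugate of $\phi_n$) such that $\int_{\mathbb T}\frac{d\zeta}{2\pi i\zeta}w(\zeta)\phi_m(\zeta)\bar\phi_n(\bar\zeta)=\delta_{m,n}$; $r_n=\phi_n(0)/\kappa_n$. Put $\phi_n^*(z)=z^n\bar\phi_n(1/z)$, $F(z)=\int_{\mathbb T}\frac{d\zeta}{2\pi i\zeta}\frac{\zeta+z}{\zeta-z}w(\zeta)$, and $\epsilon_n(z)=\int_{\mathbb T}\frac{d\zeta}{2\pi i\zeta}\frac{\zeta+z}{\zeta-z}w(\zeta)\phi_n(\zeta)$, $\epsilon_n^*(z)=-z^n\int_{\mathbb T}\frac{d\zeta}{2\pi i\zeta}\frac{\zeta+z}{\zeta-z}w(\zeta)\bar\phi_n(\bar\zeta)$ for $n\ge1$, with $\epsilon_0=\kappa_0[w_0+F]$, $\epsilon_0^*=\kappa_0[w_0-F]$. Let $Y_n=\begin{pmatrix}\phi_n&\epsilon_n/w\\ \phi_n^*&-\epsilon_n^*/w\end{pmatrix}$. **Weight.** $W(z)=z(z-1)(z-s)(z-t)=z^4-e_1z^3+e_2z^2-e_3z$,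 so $e_1=1+s+t$, $e_2=s+t+st$, $e_3=st$ (and $e_4=0$), and $$\frac{w'(z)}{w(z)}=\frac{2V(z)}{W(z)},\qquad 2V(z)=W(z)\left(\frac{\rho_0}{z}+\frac{\rho_s}{z-s}+\frac{\rho_t}{z-t}+\frac{\rho_1}{z-1}\right)=m_0z^3-m_1z^2+m_2z-m_3,$$ which defines $m_0,\dots,m_3$; in particular $m_0=\rho_0+\rho_s+\rho_t+\rho_1$, $m_3=\rho_0st$. The exponents are not non-negative integers. The weight is assumed single-valued around the circle, $w(e^{2\pi i})=w(1)$, and such that $F$ satisfies $WF'=2VF+U$ with $U$ a polynomial. The Toeplitz elements $w_j$ then satisfy a third-order linear difference equation, a solution of which is specified by $w_{-1},w_0,w_1$. **Spectral coefficients.** $\frac{d}{dz}Y_n=A_nY_n$ with $$A_n=\frac1W\begin{pmatrix}-\left[\Omega_n+V-\frac{\kappa_{n+1}}{\kappa_n}z\Theta_n\right]&\frac{\phi_{n+1}(0)}{\kappa_n}\Theta_n\\ -\frac{\bar\phi_{n+1}(0)}{\kappa_n}z\Theta_n^*&\Omega_n^*-V-\frac{\kappa_{n+1}}{\kappa_n}\Theta_n^*\end{pmatrix},$$ which defines $\Theta_n,\Omega_n,\Theta_n^*,\Omega_n^*$. Here $\Theta_n$ is a polynomial of degree 2 and $\Omega_n$ a polynomial of degree 3 in $z$, of the form $$\frac{\kappa_{n+1}}{\kappa_n}\Theta_n(z)=(n-\rho_0)e_3\frac{r_n}{r_{n+1}}+\vartheta_nz+(n+1+m_0)z^2,$$ $$\Omega_n(z)=ne_3-\tfrac12m_3+(\omega_n-\tfrac12m_2)z+(\varpi_n+\tfrac12m_1)z^2+(1+\tfrac12m_0)z^3,$$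 which defines $\vartheta_n,\omega_n,\varpi_n$. It is understood that parameters are generic, so that all quantities appearing in denominators or needed to solve the recurrences are non-zero. *)

theory Defs
  imports
    "HOL-Complex_Analysis.Complex_Analysis"
    "Jordan_Normal_Form.Determinant"
begin

definition circle_mean :: "(complex \<Rightarrow> complex) \<Rightarrow> complex" where
  "circle_mean h =
     contour_integral (circlepath 0 1) (\<lambda>\<zeta>. h \<zeta> / (2 * of_real pi * \<i> * \<zeta>))"

definition fourier :: "(complex \<Rightarrow> complex) \<Rightarrow> int \<Rightarrow> complex" where
  "fourier w k = circle_mean (\<lambda>\<zeta>. w \<zeta> * \<zeta> powi (- k))"

definition toeplitz_det :: "(complex \<Rightarrow> complex) \<Rightarrow> nat \<Rightarrow> complex" where
  "toeplitz_det w n = Determinant.det (Matrix.mat n n (\<lambda>(i, j). fourier w (int i - int j)))"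

definition caratheodory_fun :: "(complex \<Rightarrow> complex) \<Rightarrow> complex \<Rightarrow> complex" where
  "caratheodory_fun w z = circle_mean (\<lambda>\<zeta>. (\<zeta> + z) / (\<zeta> - z) * w \<zeta>)"

definition W_poly :: "complex \<Rightarrow> complex \<Rightarrow> complex poly" where
  "W_poly s t = [:0, 1:] * [:-1, 1:] * [:-s, 1:] * [:-t, 1:]"

text \<open>The polynomial \<open>2V = W (\<rho>\<^sub>0/z + \<rho>\<^sub>s/(z-s) + \<rho>\<^sub>t/(z-t) + \<rho>\<^sub>1/(z-1))\<close>, with the poles
  cancelled.\<close>

definition twoV_poly ::
    "complex \<Rightarrow> complex \<Rightarrow> complex \<Rightarrow> complex \<Rightarrow> complex \<Rightarrow> complex \<Rightarrow> complex poly" where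
  "twoV_poly s t \<rho>0 \<rho>s \<rho>t \<rho>1 =
       Polynomial.smult \<rho>0 ([:-1, 1:] * [:-s, 1:] * [:-t, 1:])
     + Polynomial.smult \<rho>s ([:0, 1:] * [:-1, 1:] * [:-t, 1:])
     + Polynomial.smult \<rho>t ([:0, 1:] * [:-1, 1:] * [:-s, 1:])
     + Polynomial.smult \<rho>1 ([:0, 1:] * [:-s, 1:] * [:-t, 1:])"

text \<open>A function \<open>w\<close> on the unit circle (its values elsewhere are irrelevant) is a semi-classical
  weight with data \<open>(W, 2V)\<close> (here the polynomials \<open>W\<close> and \<open>D\<close>) if \<open>w'/w = 2V/W\<close> along the circle
  away from the zeros of \<open>W\<close>, and \<open>W F' = 2V F + U\<close> for one and the same polynomial \<open>U\<close> inside and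
  outside the circle.  Being a function of the point \<open>\<zeta>\<close> and not of its argument, \<open>w\<close> is
  single-valued around the circle; different arcs between zeros of \<open>W\<close> may carry different
  branches.\<close>

definition semiclassical_weight ::
    "complex poly \<Rightarrow> complex poly \<Rightarrow> (complex \<Rightarrow> complex) \<Rightarrow> bool" where
  "semiclassical_weight W D w \<longleftrightarrow>
     (\<lambda>x. w (circlepath 0 1 x)) absolutely_integrable_on {0..1} \<and>
     (\<forall>\<zeta>. norm \<zeta> = 1 \<and> poly W \<zeta> \<noteq> 0 \<longrightarrow>
        w \<zeta> \<noteq> 0 \<and>
        (w has_field_derivative poly D \<zeta> / poly W \<zeta> * w \<zeta>) (at \<zeta> within sphere 0 1)) \<and>
     (\<exists>U. \<forall>z. norm z \<noteq> 1 \<longrightarrow>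
        poly W z * deriv (caratheodory_fun w) z
          = poly D z * caratheodory_fun w z + poly U z)"

text \<open>For a complex weight \<open>\<phi>b n\<close> is in general not the complex conjugate of \<open>\<phi> n\<close>.\<close>

definition biorthogonal_system ::
    "(complex \<Rightarrow> complex) \<Rightarrow> (nat \<Rightarrow> complex poly) \<Rightarrow> (nat \<Rightarrow> complex poly) \<Rightarrow> bool" where
  "biorthogonal_system w \<phi> \<phi>b \<longleftrightarrow>
     (\<forall>n. degree (\<phi> n) = n \<and> degree (\<phi>b n) = n \<and> lead_coeff (\<phi> n) = lead_coeff (\<phi>b n)) \<and>
     (\<forall>m n. circle_mean (\<lambda>\<zeta>. w \<zeta> * poly (\<phi> m) \<zeta> * poly (\<phi>b n) (cnj \<zeta>))
              = (if m = n then 1 else 0))"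

definition eps ::
    "(complex \<Rightarrow> complex) \<Rightarrow> (nat \<Rightarrow> complex poly) \<Rightarrow> nat \<Rightarrow> complex \<Rightarrow> complex" where
  "eps w \<phi> n z =
     (if n = 0 then lead_coeff (\<phi> 0) * (fourier w 0 + caratheodory_fun w z)
      else circle_mean (\<lambda>\<zeta>. (\<zeta> + z) / (\<zeta> - z) * w \<zeta> * poly (\<phi> n) \<zeta>))"

definition eps_star ::
    "(complex \<Rightarrow> complex) \<Rightarrow> (nat \<Rightarrow> complex poly) \<Rightarrow> nat \<Rightarrow> complex \<Rightarrow> complex" where
  "eps_star w \<phi>b n z =
     (if n = 0 then lead_coeff (\<phi>b 0) * (fourier w 0 - caratheodory_fun w z)
      else - (z ^ n) * circle_mean (\<lambda>\<zeta>. (\<zeta> + z) / (\<zeta> - z) * w \<zeta> * poly (\<phi>b n) (cnj \<zeta>)))"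

text \<open>Since \<open>\<phi>b n\<close> has degree \<open>n\<close>, its reflected polynomial is \<open>\<phi>*\<^sub>n(z) = z\<^sup>n \<phi>b\<^sub>n(1/z)\<close>.
  The argument \<open>v\<close> is the branch of the weight by which the second column is divided.\<close>

definition Y_mat ::
    "(complex \<Rightarrow> complex) \<Rightarrow> (nat \<Rightarrow> complex poly) \<Rightarrow> (nat \<Rightarrow> complex poly) \<Rightarrow>
     (complex \<Rightarrow> complex) \<Rightarrow> nat \<Rightarrow> complex \<Rightarrow> complex Matrix.mat" where
  "Y_mat w \<phi> \<phi>b v n z = mat_of_rows_list 2
     [[poly (\<phi> n) z,                eps w \<phi> n z / v z],
      [poly (reflect_poly (\<phi>b n)) z, - eps_star w \<phi>b n z / v z]]"

definition A_mat ::
    "complex poly \<Rightarrow> complex poly \<Rightarrow> (nat \<Rightarrow> complex poly) \<Rightarrow> (nat \<Rightarrow> complex poly) \<Rightarrow>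
     nat \<Rightarrow> complex poly \<Rightarrow> complex poly \<Rightarrow> complex poly \<Rightarrow> complex poly \<Rightarrow>
     complex \<Rightarrow> complex Matrix.mat" where
  "A_mat W D \<phi> \<phi>b n \<Theta> \<Omega> \<Theta>s \<Omega>s z =
     (let \<kappa> = lead_coeff (\<phi> n); \<kappa>' = lead_coeff (\<phi> (Suc n)); V = poly D z / 2
      in (1 / poly W z) \<cdot>\<^sub>m mat_of_rows_list 2
        [[- (poly \<Omega> z + V - \<kappa>' / \<kappa> * z * poly \<Theta> z),  poly (\<phi> (Suc n)) 0 / \<kappa> * poly \<Theta> z],
         [- (poly (\<phi>b (Suc n)) 0 / \<kappa>) * z * poly \<Theta>s z,
          poly \<Omega>s z - V - \<kappa>' / \<kappa> * poly \<Theta>s z]])"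

text \<open>The polynomials \<open>\<Theta>\<close>, \<open>\<Omega>\<close>, \<open>\<Theta>s\<close>, \<open>\<Omega>s\<close> are the spectral coefficients at level \<open>n\<close> if
  \<open>Y\<^sub>n' = A\<^sub>n Y\<^sub>n\<close> off the circle and off the zeros of \<open>W\<close>.  There the weight inside \<open>Y\<^sub>n\<close> is a
  solution of \<open>v'/v = 2V/W\<close>, determined locally up to a nonzero constant factor; that factor
  rescales the second column of \<open>Y\<^sub>n\<close> and leaves \<open>A\<^sub>n\<close> unchanged, so all local branches
  are admitted.\<close>

definition spectral_coefficients ::
    "complex poly \<Rightarrow> complex poly \<Rightarrow> (complex \<Rightarrow> complex) \<Rightarrow>
     (nat \<Rightarrow> complex poly) \<Rightarrow> (nat \<Rightarrow> complex poly) \<Rightarrow>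
     nat \<Rightarrow> complex poly \<Rightarrow> complex poly \<Rightarrow> complex poly \<Rightarrow> complex poly \<Rightarrow> bool" where
  "spectral_coefficients W D w \<phi> \<phi>b n \<Theta> \<Omega> \<Theta>s \<Omega>s \<longleftrightarrow>
     (\<forall>S v. open S \<and> S \<inter> sphere 0 1 = {} \<and>
        (\<forall>z\<in>S. poly W z \<noteq> 0 \<and> v z \<noteq> 0 \<and>
               (v has_field_derivative poly D z / poly W z * v z) (at z)) \<longrightarrow>
        (\<forall>z\<in>S. \<forall>i<2. \<forall>j<2.
           ((\<lambda>u. Y_mat w \<phi> \<phi>b v n u $$ (i, j)) has_field_derivative
              (A_mat W D \<phi> \<phi>b n \<Theta> \<Omega> \<Theta>s \<Omega>s z * Y_mat w \<phi> \<phi>b v n z) $$ (i, j)) (at z)))"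

definition garnier_recurrences ::
    "complex \<Rightarrow> complex \<Rightarrow> complex \<Rightarrow> complex \<Rightarrow> complex \<Rightarrow> complex \<Rightarrow>
     complex \<Rightarrow> complex \<Rightarrow> complex \<Rightarrow>
     (nat \<Rightarrow> complex) \<Rightarrow> (nat \<Rightarrow> complex) \<Rightarrow> (nat \<Rightarrow> complex) \<Rightarrow> (nat \<Rightarrow> complex) \<Rightarrow> bool" where
  "garnier_recurrences s t \<rho>0 \<rho>s \<rho>t \<rho>1 m0 m1 m2 f g \<omega> varpi \<longleftrightarrow>
   (\<forall>n. s * f n * f (n + 1) =
      ((\<omega> n + s * varpi n + (1 + m0) * s^2 + (of_nat n - \<rho>0) * t + \<rho>s * (s - t) * (1 - s))
         * (\<omega> n + s * varpi n + (1 + m0) * s^2 + (of_nat n - \<rho>0) * t))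
      / ((\<omega> n + varpi n + 1 + m0 + (of_nat n - \<rho>0) * s * t + \<rho>1 * (1 - s) * (t - 1))
         * (\<omega> n + varpi n + 1 + m0 + (of_nat n - \<rho>0) * s * t))) \<and>
   (\<forall>n. t * g n * g (n + 1) =
      ((\<omega> n + t * varpi n + (1 + m0) * t^2 + (of_nat n - \<rho>0) * s + \<rho>t * (t - s) * (1 - t))
         * (\<omega> n + t * varpi n + (1 + m0) * t^2 + (of_nat n - \<rho>0) * s))
      / ((\<omega> n + varpi n + 1 + m0 + (of_nat n - \<rho>0) * s * t + \<rho>1 * (1 - s) * (t - 1))
         * (\<omega> n + varpi n + 1 + m0 + (of_nat n - \<rho>0) * s * t))) \<and>
   (\<forall>n\<ge>1. \<omega> n + \<omega> (n - 1) =
      m2 - (of_nat n - 1) * (s + t + s * t)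
      + (of_nat n - \<rho>0) *
          ((s^2 - t^2 + (1 - s^2) * t * g n - (1 - t^2) * s * f n)
           / (t - s + (1 - t) * f n - (1 - s) * g n))
      + (of_nat n + 1 + m0) * s * t *
          ((t - s + (1 - t) * f n - (1 - s) * g n)
           / (t - s + (1 - t) * s * f n - (1 - s) * t * g n))) \<and>
   (\<forall>n\<ge>1. varpi n + varpi (n - 1) =
      - m1 + (of_nat n - 1) * (1 + s + t)
      + (of_nat n - \<rho>0) *
          ((t - s + (1 - t) * s * f n - (1 - s) * t * g n)
           / (t - s + (1 - t) * f n - (1 - s) * g n))
      + (of_nat n + 1 + m0) *
          ((s^2 - t^2 + (1 - s^2) * t * g n - (1 - t^2) * s * f n)
           / (t - s + (1 - t) * s * f n - (1 - s) * t * g n)))"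

text \<open>Here \<open>wm\<close>, \<open>w0\<close>, \<open>w1\<close> stand for \<open>w\<^sub>-\<^sub>1\<close>, \<open>w\<^sub>0\<close>, \<open>w\<^sub>1\<close>.\<close>

definition garnier_initial ::
    "complex \<Rightarrow> complex \<Rightarrow> complex \<Rightarrow> complex \<Rightarrow> complex \<Rightarrow> complex \<Rightarrow>
     complex \<Rightarrow> complex \<Rightarrow> complex \<Rightarrow> complex \<Rightarrow>
     (nat \<Rightarrow> complex) \<Rightarrow> (nat \<Rightarrow> complex) \<Rightarrow> (nat \<Rightarrow> complex) \<Rightarrow> (nat \<Rightarrow> complex) \<Rightarrow> bool" where
  "garnier_initial s t \<rho>0 \<rho>s \<rho>t \<rho>1 m0 wm w0 w1 f g \<omega> varpi \<longleftrightarrow>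
   f 0 =
     ((1 + m0) * s * wm - (\<rho>0 * s * (t + 1) + \<rho>1 * s * t + \<rho>s * t + \<rho>t * s) * w0
        - (1 - \<rho>0) * s * t * w1)
     / ((1 + m0) * wm - (\<rho>0 * (s + t) + \<rho>1 * s * t + \<rho>s * t + \<rho>t * s) * w0
        - (1 - \<rho>0) * s * t * w1) \<and>
   g 0 =
     ((1 + m0) * t * wm - (\<rho>0 * t * (s + 1) + \<rho>1 * s * t + \<rho>s * t + \<rho>t * s) * w0
        - (1 - \<rho>0) * s * t * w1)
     / ((1 + m0) * wm - (\<rho>0 * (s + t) + \<rho>1 * s * t + \<rho>s * t + \<rho>t * s) * w0
        - (1 - \<rho>0) * s * t * w1) \<and>
   \<omega> 0 =
     (1 - \<rho>0) * s * t * (w1 / w0) + \<rho>0 * s * t * (w0 / wm)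
     + \<rho>0 * (s + t + s * t) + \<rho>1 * s * t + \<rho>s * t + \<rho>t * s \<and>
   varpi 0 =
     - (1 + m0) * (wm / w0) - (1 - \<rho>0) * s * t * (w1 / wm)
     - (\<rho>0 * (s + t + s * t) + \<rho>1 * s * t + \<rho>s * t + \<rho>t * s) * (w0 / wm)"

end

theory Submission
  imports Defs
begin

text \<open>Multiplying out the spectral equation \<open>Y\<^sub>n' = A\<^sub>n Y\<^sub>n\<close> with the recurrences in \<open>n\<close>
  eliminates the starred functions and leaves \<open>W \<phi>\<^sub>n' = \<Theta>\<^sub>n \<phi>\<^sub>n\<^sub>+\<^sub>1 - (\<Omega>\<^sub>n
  + V) \<phi>\<^sub>n\<close> and \<open>W \<epsilon>\<^sub>n' = \<Theta>\<^sub>n \<epsilon>\<^sub>n\<^sub>+\<^sub>1 - (\<Omega>\<^sub>n - V)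
  \<epsilon>\<^sub>n\<close>, where \<open>\<phi>\<close> and \<open>\<epsilon>\<close> satisfy one and the same three-term
  recurrence and the Casoratian \<open>\<phi>\<^sub>n\<^sub>+\<^sub>1 \<epsilon>\<^sub>n - \<phi>\<^sub>n \<epsilon>\<^sub>n\<^sub>+\<^sub>1\<close> is a
  constant times \<open>z\<^sup>n\<close>. Differentiating the Casoratian gives a formula for \<open>\<Omega>\<^sub>n\<^sub>+\<^sub>1 +
  \<Omega>\<^sub>n\<close> in terms of \<open>\<Theta>\<^sub>n\<^sub>+\<^sub>1\<close>. At a zero \<open>x \<noteq> 0\<close> of \<open>W\<close> the first equation
  is a linear system for \<open>(\<phi>\<^sub>n(x), \<phi>\<^sub>n\<^sub>+\<^sub>1(x)) \<noteq> 0\<close>, so its determinant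
  vanishes, which is \<open>\<Omega>\<^sub>n\<^sup>2 - V\<^sup>2 = d x \<Theta>\<^sub>n \<Theta>\<^sub>n\<^sub>+\<^sub>1\<close> with \<open>d\<close> independent of
  \<open>x\<close>. The outer coefficients of \<open>\<Theta>\<^sub>n\<close> and \<open>\<Omega>\<^sub>n\<close> come from the expansions of
  \<open>\<phi>\<^sub>n\<close> and \<open>\<epsilon>\<^sub>n\<close> at \<open>0\<close> and \<open>\<infinity>\<close>, and the three coefficients of
  \<open>\<Theta>\<^sub>n\<close> are recovered from its values at \<open>1, s, t\<close>, that is, from \<open>f\<^sub>n\<close> and \<open>g\<^sub>n\<close>.\<close>

section \<open>Moments of an integrable weight\<close>

text \<open>The kernel 1/(2 pi i \<zeta>) cancels the derivative of the parametrised circle, so all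
  estimates can be made on the interval [0,1].\<close>

lemma circle_mean_eq_integral:
  "circle_mean h = integral {0..1} (\<lambda>x. h (circlepath 0 1 x))"
proof -
  have "h (circlepath 0 1 x) / (2 * of_real pi * \<i> * circlepath 0 1 x) *
          vector_derivative (circlepath 0 1) (at x) = h (circlepath 0 1 x)" for x
    by (simp add: vector_derivative_circlepath) (simp add: circlepath)
  then show ?thesis
    by (simp add: circle_mean_def contour_integral_integral)
qed

lemma circlepath_in_sphere: "circlepath 0 1 x \<in> sphere (0::complex) 1"
  by (simp add: circlepath norm_mult)

lemma circle_mean_cong:
  assumes "\<And>\<zeta>. norm \<zeta> = 1 \<Longrightarrow> h \<zeta> = h' \<zeta>"
  shows "circle_mean h = circle_mean h'"
  unfolding circle_mean_eq_integral
  by (rule integral_cong) (use assms circlepath_in_sphere in simp)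

locale integrable_weight =
  fixes w :: "complex \<Rightarrow> complex"
  assumes integrable: "(\<lambda>x. w (circlepath 0 1 x)) absolutely_integrable_on {0..1}"
begin

definition moment :: "(complex \<Rightarrow> complex) \<Rightarrow> complex" where
  "moment g = circle_mean (\<lambda>\<zeta>. w \<zeta> * g \<zeta>)"

definition mass :: real where
  "mass = integral {0..1} (\<lambda>x. norm (w (circlepath 0 1 x)))"

lemma moment_cong:
  assumes "\<And>\<zeta>. norm \<zeta> = 1 \<Longrightarrow> g \<zeta> = h \<zeta>"
  shows "moment g = moment h"
  unfolding moment_def by (rule circle_mean_cong) (simp add: assms)

lemma integrable_mult_continuous:
  assumes g: "continuous_on (sphere 0 1) g"
  shows "(\<lambda>x. w (circlepath 0 1 x) * g (circlepath 0 1 x)) absolutely_integrable_on {0..1}"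
proof -
  have c: "continuous_on {0..1} (\<lambda>x. g (circlepath 0 1 x))"
  proof (rule continuous_on_compose2[OF g])
    show "continuous_on {0..1} (circlepath (0::complex) 1)"
      by (simp add: circlepath_def part_circlepath_def continuous_intros)
  qed (use circlepath_in_sphere in blast)
  \<comment> \<open>The rule takes the bounded measurable factor first, hence the swapped
    product.\<close>
  have "(\<lambda>x. (\<lambda>a b. b * a) (g (circlepath 0 1 x)) (w (circlepath 0 1 x)))
          absolutely_integrable_on {0..1}"
  proof (rule absolutely_integrable_bounded_measurable_product
      [where h = "\<lambda>a b. b * a", OF _ _ _ _ integrable])
    show "bilinear (\<lambda>a b::complex. b * a)"
      by (auto simp: bilinear_def linear_iff algebra_simps)
    show "(\<lambda>x. g (circlepath 0 1 x)) \<in> borel_measurable (lebesgue_on {0..1})"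
      by (rule continuous_imp_measurable_on_sets_lebesgue[OF c]) simp
    show "bounded ((\<lambda>x. g (circlepath 0 1 x)) ` {0..1})"
      by (rule compact_imp_bounded[OF compact_continuous_image[OF c]]) simp
  qed simp
  then show ?thesis by simp
qed

lemma moment_add:
  assumes "continuous_on (sphere 0 1) g" "continuous_on (sphere 0 1) h"
  shows "moment (\<lambda>\<zeta>. g \<zeta> + h \<zeta>) = moment g + moment h"
  using integrable_mult_continuous[OF assms(1)] integrable_mult_continuous[OF assms(2)]
  by (simp add: moment_def circle_mean_eq_integral distrib_left absolutely_integrable_on_def
      Henstock_Kurzweil_Integration.integral_add)

lemma moment_cmult: "moment (\<lambda>\<zeta>. c * g \<zeta>) = c * moment g"
  by (simp add: moment_def circle_mean_eq_integral mult.left_commute[of _ c])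

lemma moment_diff:
  assumes "continuous_on (sphere 0 1) g" "continuous_on (sphere 0 1) h"
  shows "moment (\<lambda>\<zeta>. g \<zeta> - h \<zeta>) = moment g - moment h"
  using integrable_mult_continuous[OF assms(1)] integrable_mult_continuous[OF assms(2)]
  by (simp add: moment_def circle_mean_eq_integral right_diff_distrib absolutely_integrable_on_def
      Henstock_Kurzweil_Integration.integral_diff)

lemma moment_zero [simp]: "moment (\<lambda>\<zeta>. 0) = 0"
  by (simp add: moment_def circle_mean_eq_integral)

lemma norm_moment_le:
  assumes "continuous_on (sphere 0 1) g" "\<And>\<zeta>. norm \<zeta> = 1 \<Longrightarrow> norm (g \<zeta>) \<le> B"
  shows "norm (moment g) \<le> B * mass"
proof -
  have "norm (moment g) \<le> integral {0..1} (\<lambda>x. B * norm (w (circlepath 0 1 x)))"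
    unfolding moment_def circle_mean_eq_integral
  proof (rule integral_norm_bound_integral)
    show "(\<lambda>x. B * norm (w (circlepath 0 1 x))) integrable_on {0..1}"
      using integrable_on_cmult_left[of "\<lambda>x. norm (w (circlepath 0 1 x))" "{0..1}" B] integrable
      by (simp add: absolutely_integrable_on_def)
    show "norm (w (circlepath 0 1 x) * g (circlepath 0 1 x)) \<le> B * norm (w (circlepath 0 1 x))"
      for x
      using assms(2)[of "circlepath 0 1 x"] circlepath_in_sphere[of x]
      by (simp add: norm_mult mult.commute mult_right_mono)
  qed (use integrable_mult_continuous[OF assms(1)] in \<open>simp add: absolutely_integrable_on_def\<close>)
  then show ?thesis by (simp add: mass_def)
qed

section \<open>Geometric expansion of Cauchy transforms\<close>

text \<open>With \<open>q \<zeta> = 1 / \<zeta>\<close> this is a Cauchy transform inside the circle, and with \<open>q \<zeta> = \<zeta>\<close>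
  one outside, in the variable \<open>u = 1 / z\<close>.\<close>

definition resolvent :: "(complex \<Rightarrow> complex) \<Rightarrow> (complex \<Rightarrow> complex) \<Rightarrow> complex \<Rightarrow> complex" where
  "resolvent q g u = moment (\<lambda>\<zeta>. g \<zeta> / (1 - q \<zeta> * u))"

lemma continuous_on_resolvent_kernel:
  fixes q g :: "complex \<Rightarrow> complex"
  assumes "continuous_on (sphere 0 1) q" "\<And>\<zeta>. norm \<zeta> = 1 \<Longrightarrow> norm (q \<zeta>) = 1"
    and "continuous_on (sphere 0 1) g" "norm u < 1"
  shows "continuous_on (sphere 0 1) (\<lambda>\<zeta>. g \<zeta> / (1 - q \<zeta> * u))"
proof (rule continuous_on_divide[OF assms(3)])
  show "continuous_on (sphere 0 1) (\<lambda>\<zeta>. 1 - q \<zeta> * u)"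
    by (intro continuous_intros assms(1))
  show "\<forall>\<zeta>\<in>sphere 0 1. 1 - q \<zeta> * u \<noteq> 0"
  proof
  fix \<zeta> :: complex assume "\<zeta> \<in> sphere 0 1"
  then have "norm (q \<zeta> * u) < 1" using assms by (simp add: norm_mult)
  then show "1 - q \<zeta> * u \<noteq> 0" by auto
  qed
qed

text \<open>One step of the geometric series: 1/(1 - x) = 1 + x/(1 - x) with x = q(\<zeta>)
  u.\<close>

lemma resolvent_step:
  assumes "continuous_on (sphere 0 1) q" "\<And>\<zeta>. norm \<zeta> = 1 \<Longrightarrow> norm (q \<zeta>) = 1"
    and "continuous_on (sphere 0 1) g" "norm u < 1"
  shows "resolvent q g u = moment g + u * resolvent q (\<lambda>\<zeta>. g \<zeta> * q \<zeta>) u"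
proof -
  have "resolvent q g u = moment (\<lambda>\<zeta>. g \<zeta> + u * (g \<zeta> * q \<zeta> / (1 - q \<zeta> * u)))"
    unfolding resolvent_def
  proof (rule moment_cong)
    fix \<zeta> :: complex assume "norm \<zeta> = 1"
    then have "norm (q \<zeta> * u) < 1" using assms by (simp add: norm_mult)
    then have "1 - q \<zeta> * u \<noteq> 0" by auto
    then show "g \<zeta> / (1 - q \<zeta> * u) = g \<zeta> + u * (g \<zeta> * q \<zeta> / (1 - q \<zeta> * u))"
      by (simp add: field_simps)
  qed
  also have "\<dots> = moment g + u * resolvent q (\<lambda>\<zeta>. g \<zeta> * q \<zeta>) u"
    unfolding resolvent_def using assms
    by (subst moment_add; simp add: moment_cmult[symmetric] continuous_on_resolvent_kernel
        continuous_on_mult continuous_on_const flip: times_divide_eq_right)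
  finally show ?thesis .
qed

text \<open>The remainder is again a resolvent, so the identity is exact. It serves twice: for
  convergence of the series, and to split off a power of u when the first moments vanish.\<close>

lemma resolvent_partial_sum:
  assumes "continuous_on (sphere 0 1) q" "\<And>\<zeta>. norm \<zeta> = 1 \<Longrightarrow> norm (q \<zeta>) = 1"
    and "continuous_on (sphere 0 1) g" "norm u < 1"
  shows "resolvent q g u =
    (\<Sum>k<n. moment (\<lambda>\<zeta>. g \<zeta> * q \<zeta> ^ k) * u ^ k) + u ^ n * resolvent q (\<lambda>\<zeta>. g \<zeta> * q \<zeta> ^ n) u"
proof (induction n)
  case (Suc n)
  have "continuous_on (sphere 0 1) (\<lambda>\<zeta>. g \<zeta> * q \<zeta> ^ n)"
    by (intro continuous_intros assms)
  from resolvent_step[OF assms(1,2) this assms(4)] Suc show ?case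
    by (simp add: algebra_simps)
qed simp

text \<open>The resolvent is the sum of the power series of its moments: since |q| = 1 on the
  circle, the remainder integrals stay bounded in n while their factor \<open>u ^ n\<close> tends to
  0.\<close>

lemma holomorphic_resolvent:
  assumes q: "continuous_on (sphere 0 1) q" "\<And>\<zeta>. norm \<zeta> = 1 \<Longrightarrow> norm (q \<zeta>) = 1"
    and g: "continuous_on (sphere 0 1) g"
  shows "resolvent q g holomorphic_on ball 0 1"
proof (rule power_series_holomorphic)
  fix u :: complex assume "u \<in> ball 0 1"
  then have u: "norm u < 1" by simp
  obtain M where M: "\<And>\<zeta>. norm \<zeta> = 1 \<Longrightarrow> norm (g \<zeta>) \<le> M"
    using compact_imp_bounded[OF compact_continuous_image[OF g compact_sphere]]
    by (metis bounded_iff imageI mem_sphere_0)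
  define B where "B = M / (1 - norm u) * mass"
  have bound: "norm (resolvent q (\<lambda>\<zeta>. g \<zeta> * q \<zeta> ^ n) u) \<le> B" for n
    unfolding resolvent_def B_def
  proof (rule norm_moment_le)
    show "continuous_on (sphere 0 1) (\<lambda>\<zeta>. g \<zeta> * q \<zeta> ^ n / (1 - q \<zeta> * u))"
      using q u by (intro continuous_on_resolvent_kernel) (auto intro!: continuous_intros g)
    fix \<zeta> :: complex assume z: "norm \<zeta> = 1"
    have "norm (1 - q \<zeta> * u) \<ge> 1 - norm u"
      using norm_triangle_ineq2[of 1 "q \<zeta> * u"] q(2)[OF z] by (simp add: norm_mult)
    then show "norm (g \<zeta> * q \<zeta> ^ n / (1 - q \<zeta> * u)) \<le> M / (1 - norm u)"
      using M[OF z] u q(2)[OF z]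
      by (auto simp: norm_divide norm_mult norm_power intro!: frac_le)
        (metis M norm_ge_zero order_trans z)
  qed
  have "(\<lambda>n. u ^ n * resolvent q (\<lambda>\<zeta>. g \<zeta> * q \<zeta> ^ n) u) \<longlonglongrightarrow> 0"
  proof (rule Lim_null_comparison)
    show "\<forall>\<^sub>F n in sequentially.
        norm (u ^ n * resolvent q (\<lambda>\<zeta>. g \<zeta> * q \<zeta> ^ n) u) \<le> norm u ^ n * B"
      using bound by (intro always_eventually) (simp add: norm_mult norm_power mult_left_mono)
    show "(\<lambda>n. norm u ^ n * B) \<longlonglongrightarrow> 0"
      using u by (intro tendsto_mult_left_zero LIMSEQ_power_zero) simp
  qed
  moreover have partial: "(\<Sum>k<n. moment (\<lambda>\<zeta>. g \<zeta> * q \<zeta> ^ k) * u ^ k) =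
      resolvent q g u - u ^ n * resolvent q (\<lambda>\<zeta>. g \<zeta> * q \<zeta> ^ n) u" for n
    using resolvent_partial_sum[OF q g u, of n] by simp
  ultimately have "(\<lambda>n. resolvent q g u - u ^ n * resolvent q (\<lambda>\<zeta>. g \<zeta> * q \<zeta> ^ n) u)
      \<longlonglongrightarrow> resolvent q g u"
    using tendsto_diff[OF tendsto_const[of "resolvent q g u"]] by fastforce
  then
  show "(\<lambda>k. moment (\<lambda>\<zeta>. g \<zeta> * q \<zeta> ^ k) * (u - 0) ^ k) sums resolvent q g u"
    by (simp add: sums_def partial)
qed

end

section \<open>Biorthogonal polynomials and their Cauchy transforms\<close>

lemma poly_1_eq: "poly (1 :: complex poly) = (\<lambda>_. 1)"
  by (rule ext) simp

lemma inverse_eq_cnj: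
  assumes "norm z = 1"
  shows "inverse z = cnj z"
  using complex_norm_square[of z] assms by (intro inverse_unique) simp

text \<open>Subtracting the multiple of \<open>\<psi> d\<close> that cancels the leading term lowers
  the degree, and only the multiple of \<open>\<psi> n\<close> contributes to T. The functional is
  abstract so that both slots of the pairing are covered.\<close>

lemma triangular_functional:
  fixes T :: "complex poly \<Rightarrow> complex" and \<psi> :: "nat \<Rightarrow> complex poly"
  assumes add: "\<And>p q. T (p + q) = T p + T q"
    and smult: "\<And>c p. T (Polynomial.smult c p) = c * T p"
    and deg: "\<And>m. degree (\<psi> m) = m"
    and nz: "\<And>m. \<psi> m \<noteq> 0"
    and val: "\<And>m. m \<le> n \<Longrightarrow> T (\<psi> m) = (if m = n then 1 else 0)"
  shows "degree q \<le> n \<Longrightarrow> T q = poly.coeff q n / poly.coeff (\<psi> n) n"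
proof (induction "degree q" arbitrary: q rule: less_induct)
  case less
  define d where "d = degree q"
  define c where "c = poly.coeff q d / poly.coeff (\<psi> d) d"
  define q' where "q' = q - Polynomial.smult c (\<psi> d)"
  have lead: "poly.coeff (\<psi> d) d \<noteq> 0"
    using nz[of d] deg[of d] by (metis leading_coeff_neq_0)
  have "poly.coeff q' d = 0" using lead by (simp add: q'_def c_def)
  moreover have "degree q' \<le> d"
    by (simp add: q'_def d_def deg degree_diff_le)
  ultimately have q': "q' = 0 \<or> degree q' < d"
    by (metis eq_zero_or_degree_less)
  have "T q' = 0"
  proof (cases "q' = 0")
    case True
    then show ?thesis using smult[of 0 0] by simp
  next
    case False
    with q' less have "T q' = poly.coeff q' n / poly.coeff (\<psi> n) n" "degree q' < n"
      by (auto simp: d_def)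
    then show ?thesis by (simp add: coeff_eq_0)
  qed
  moreover have "q = q' + Polynomial.smult c (\<psi> d)" by (simp add: q'_def)
  ultimately have "T q = T (Polynomial.smult c (\<psi> d))"
    using add[of q' "Polynomial.smult c (\<psi> d)"] by simp
  also have "\<dots> = c * (if d = n then 1 else 0)"
    using less.prems by (simp add: smult val d_def)
  finally show ?case
    using less.prems by (auto simp: c_def d_def coeff_eq_0)
qed

section \<open>The bilinear pairing and orthogonality\<close>

locale biorthogonal_polynomials = integrable_weight +
  fixes \<phi> \<phi>b :: "nat \<Rightarrow> complex poly"
  assumes biorthogonal: "biorthogonal_system w \<phi> \<phi>b"
begin

definition \<kappa> :: "nat \<Rightarrow> complex" where
  "\<kappa> n = lead_coeff (\<phi> n)"

text \<open>On the circle \<open>inverse \<zeta>\<close> equals \<open>cnj \<zeta>\<close>; in this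
  form powers of \<zeta> can be moved between the two slots.\<close>

definition pairing :: "complex poly \<Rightarrow> complex poly \<Rightarrow> complex" where
  "pairing p q = moment (\<lambda>\<zeta>. poly p \<zeta> * poly q (inverse \<zeta>))"

lemma degree_phi [simp]: "degree (\<phi> n) = n" "degree (\<phi>b n) = n"
  using biorthogonal by (auto simp: biorthogonal_system_def)

lemma coeff_phi [simp]: "poly.coeff (\<phi> n) n = \<kappa> n" "poly.coeff (\<phi>b n) n = \<kappa> n"
  using biorthogonal unfolding biorthogonal_system_def \<kappa>_def by metis+

lemma pairing_phi: "pairing (\<phi> m) (\<phi>b n) = (if m = n then 1 else 0)"
proof -
  have "pairing (\<phi> m) (\<phi>b n) =
      circle_mean (\<lambda>\<zeta>. w \<zeta> * poly (\<phi> m) \<zeta> * poly (\<phi>b n) (cnj \<zeta>))"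
    unfolding pairing_def moment_def
  proof (rule circle_mean_cong)
    show "w \<zeta> * (poly (\<phi> m) \<zeta> * poly (\<phi>b n) (inverse \<zeta>)) =
        w \<zeta> * poly (\<phi> m) \<zeta> * poly (\<phi>b n) (cnj \<zeta>)" if "norm \<zeta> = 1" for \<zeta>
      by (simp add: inverse_eq_cnj[OF that] mult.assoc)
  qed
  then show ?thesis
    using biorthogonal by (simp add: biorthogonal_system_def)
qed

lemma continuous_on_poly_circle [continuous_intros]:
  "continuous_on (sphere 0 1) (\<lambda>\<zeta>. poly p (inverse \<zeta>) :: complex)"
  by (intro continuous_intros) auto

lemma pairing_add_left: "pairing (p + q) r = pairing p r + pairing q r"
  unfolding pairing_def poly_add distrib_right
  by (intro moment_add continuous_intros)

lemma pairing_add_right: "pairing p (q + r) = pairing p q + pairing p r"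
  unfolding pairing_def poly_add distrib_left
  by (intro moment_add continuous_intros)

lemma pairing_smult_left: "pairing (Polynomial.smult c p) q = c * pairing p q"
  by (simp add: pairing_def mult.assoc moment_cmult)

lemma pairing_smult_right: "pairing p (Polynomial.smult c q) = c * pairing p q"
  by (simp add: pairing_def mult.left_commute[of _ c] moment_cmult)

lemma pairing_diff_left: "pairing (p - q) r = pairing p r - pairing q r"
  using pairing_add_left[of "p - q" q r] by simp

lemma pairing_pCons_pCons: "pairing (pCons 0 p) (pCons 0 q) = pairing p q"
  unfolding pairing_def
proof (rule moment_cong)
  fix \<zeta> :: complex assume "norm \<zeta> = 1"
  then have "\<zeta> \<noteq> 0" by auto
  then show "poly (pCons 0 p) \<zeta> * poly (pCons 0 q) (inverse \<zeta>) =
      poly p \<zeta> * poly q (inverse \<zeta>)"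
    by simp
qed

lemma phi_nonzero: "\<phi> n \<noteq> 0" "\<phi>b n \<noteq> 0"
proof -
  have "pairing 0 (\<phi>b n) = 0" "pairing (\<phi> n) 0 = 0"
    by (simp_all add: pairing_def)
  with pairing_phi[of n n] show "\<phi> n \<noteq> 0" "\<phi>b n \<noteq> 0"
    by auto
qed

lemma kappa_nonzero [simp]: "\<kappa> n \<noteq> 0"
  using phi_nonzero(1)[of n] by (simp only: \<kappa>_def leading_coeff_0_iff not_False_eq_True)

lemma pairing_phi_left: "degree q \<le> n \<Longrightarrow> pairing (\<phi> n) q = poly.coeff q n / \<kappa> n"
  using triangular_functional[of "pairing (\<phi> n)" \<phi>b n q]
  by (simp add: pairing_add_right pairing_smult_right pairing_phi phi_nonzero)

lemma pairing_phib_right: "degree p \<le> n \<Longrightarrow> pairing p (\<phi>b n) = poly.coeff p n / \<kappa> n"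
  using triangular_functional[of "\<lambda>p. pairing p (\<phi>b n)" \<phi> n p]
  by (simp add: pairing_add_left pairing_smult_left pairing_phi phi_nonzero)

text \<open>A nonzero difference p would have some degree d < n. Its pairing with
  \<open>\<phi>b d\<close> would be 0 by orthogonality, yet equal to the leading coefficient of p
  divided by \<open>\<kappa> d\<close>.\<close>

lemma orthogonal_imp_smult_phi:
  assumes deg: "degree q \<le> n" and orth: "\<And>r. degree r < n \<Longrightarrow> pairing q r = 0"
  shows "q = Polynomial.smult (poly.coeff q n / \<kappa> n) (\<phi> n)"
proof (rule ccontr)
  define p where "p = q - Polynomial.smult (poly.coeff q n / \<kappa> n) (\<phi> n)"
  assume "\<not> ?thesis"
  then have "p \<noteq> 0" by (simp add: p_def)
  moreover have "poly.coeff p n = 0" "degree p \<le> n"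
    by (auto simp: p_def deg intro!: degree_diff_le)
  ultimately have "degree p < n"
    by (metis eq_zero_or_degree_less)
  then have "pairing p (\<phi>b (degree p)) = 0"
    by (simp add: p_def pairing_diff_left pairing_smult_left orth pairing_phi del: coeff_phi)
  with \<open>p \<noteq> 0\<close> show False
    by (simp add: pairing_phib_right)
qed

text \<open>The factor \<zeta>^n of the reflected polynomial is moved over to r(1/\<zeta>), where it
  produces a polynomial of degree at most n whose coefficient at n is r(0).\<close>

lemma pairing_reflect:
  assumes "degree r \<le> n"
  shows "pairing (reflect_poly (\<phi>b n)) r = poly.coeff r 0 / \<kappa> n"
proof -
  \<comment> \<open>This is \<zeta>^n r(1/\<zeta>); the monomial makes up for the reflection using
    only the actual degree of r.\<close>
  define p where "p = Polynomial.monom 1 (n - degree r) * reflect_poly r"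
  have "pairing (reflect_poly (\<phi>b n)) r = pairing p (\<phi>b n)"
    unfolding pairing_def
  proof (rule moment_cong)
    fix \<zeta> :: complex assume "norm \<zeta> = 1"
    then have "\<zeta> \<noteq> 0" by auto
    then show "poly (reflect_poly (\<phi>b n)) \<zeta> * poly r (inverse \<zeta>) =
        poly p \<zeta> * poly (\<phi>b n) (inverse \<zeta>)"
      using assms by (simp add: p_def poly_reflect_poly_nz poly_monom flip: power_add)
  qed
  also have "\<dots> = poly.coeff p n / \<kappa> n"
    by (rule pairing_phib_right)
      (use assms in \<open>auto simp: p_def degree_monom_eq
        intro!: order_trans[OF degree_mult_le] order_trans[OF add_left_mono[OF degree_reflect_poly_le]]\<close>)
  also have "poly.coeff p n = poly.coeff r 0"
    using assms by (simp add: p_def coeff_monom_mult coeff_reflect_poly)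
  finally show ?thesis .
qed

section \<open>Recurrences in the degree\<close>

definition first_moment :: "nat \<Rightarrow> complex" where
  "first_moment n = moment (\<lambda>\<zeta>. \<zeta> * poly (\<phi> n) \<zeta>)"

lemma first_moment_eq_pairing: "first_moment n = pairing (pCons 0 (\<phi> n)) 1"
  by (simp add: first_moment_def pairing_def)

text \<open>The Szego recurrence. The difference of the two sides vanishes at 0, so it is z q(z).
  Its coefficient at n + 1 cancels too, and q is orthogonal to all lower degrees, so q is a multiple
  of \<open>\<phi> n\<close> with vanishing top coefficient.\<close>

lemma phi_Suc:
  "Polynomial.smult (\<kappa> n) (\<phi> (Suc n)) = Polynomial.smult (\<kappa> (Suc n)) (pCons 0 (\<phi> n))
     + Polynomial.smult (poly (\<phi> (Suc n)) 0) (reflect_poly (\<phi>b n))"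
proof -
  define p where "p = Polynomial.smult (\<kappa> n) (\<phi> (Suc n))
     - Polynomial.smult (\<kappa> (Suc n)) (pCons 0 (\<phi> n))
     - Polynomial.smult (poly (\<phi> (Suc n)) 0) (reflect_poly (\<phi>b n))"
  have "poly.coeff p 0 = 0"
    by (simp add: p_def poly_0_coeff_0)
  then obtain q where q: "p = pCons 0 q"
    by (metis pCons_cases coeff_pCons_0)
  have refl: "degree (reflect_poly (\<phi>b n)) \<le> n"
    using degree_reflect_poly_le[of "\<phi>b n"] by simp
  have "degree p \<le> Suc n"
    unfolding p_def using refl
    by (intro degree_diff_le order_trans[OF degree_smult_le])
      (auto intro: order_trans[OF degree_pCons_le])
  then have deg: "degree q \<le> n"
    by (auto simp: q degree_pCons_eq_if split: if_splits)
  have "poly.coeff p (Suc n) = 0"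
    using refl by (simp add: p_def coeff_eq_0)
  then have lead: "poly.coeff q n = 0"
    by (simp add: q)
  have "pairing q r = 0" if r: "degree r < n" for r
  proof -
    have "degree (pCons 0 r) \<le> n" using r by (simp add: degree_pCons_le le_less_trans Suc_leI degree_pCons_eq_if)
    then have "pairing p (pCons 0 r) = 0"
      using r by (simp add: p_def pairing_diff_left pairing_smult_left pairing_pCons_pCons
          pairing_phi_left pairing_reflect coeff_eq_0)
    then show ?thesis
      by (simp add: q pairing_pCons_pCons)
  qed
  from orthogonal_imp_smult_phi[OF deg this] lead have "p = 0"
    by (simp add: q)
  then show ?thesis
    by (simp add: p_def algebra_simps)
qed

text \<open>Pairing the Szego recurrence with 1 annihilates its left side. Thus
  \<open>first_moment\<close> is the reflection coefficient up to normalisation.\<close>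

lemma phi_Suc_at_0: "poly (\<phi> (Suc n)) 0 = - (\<kappa> n * \<kappa> (Suc n) * first_moment n)"
proof -
  have "pairing (Polynomial.smult (\<kappa> n) (\<phi> (Suc n))) 1 = 0"
    by (simp add: pairing_smult_left pairing_phi_left)
  then have "\<kappa> (Suc n) * first_moment n + poly (\<phi> (Suc n)) 0 / \<kappa> n = 0"
    unfolding phi_Suc pairing_add_left pairing_smult_left
    by (simp add: first_moment_eq_pairing pairing_reflect)
  then show ?thesis
    by (simp add: field_simps eq_neg_iff_add_eq_0)
qed

definition recurrence_factor :: "nat \<Rightarrow> complex poly" where
  "recurrence_factor n =
    [:poly (\<phi> (Suc (Suc n))) 0 / poly (\<phi> (Suc n)) 0, \<kappa> (Suc (Suc n)) / \<kappa> (Suc n):]"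

text \<open>The linear factor is chosen to match the value at 0 and the leading coefficient. The
  rest is z times a polynomial of degree at most n orthogonal to all lower degrees, hence a multiple
  of z \<open>\<phi> n\<close>. The value of d is left implicit; its product with a first moment is
  computed later.\<close>

lemma three_term:
  assumes "poly (\<phi> (Suc n)) 0 \<noteq> 0"
  obtains d where
    "\<phi> (Suc (Suc n)) = recurrence_factor n * \<phi> (Suc n) - Polynomial.smult d (pCons 0 (\<phi> n))"
proof -
  define c k where "c = poly (\<phi> (Suc (Suc n))) 0 / poly (\<phi> (Suc n)) 0"
    and "k = \<kappa> (Suc (Suc n)) / \<kappa> (Suc n)"
  define p where "p = \<phi> (Suc (Suc n)) - Polynomial.smult c (\<phi> (Suc n))
    - Polynomial.smult k (pCons 0 (\<phi> (Suc n)))"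
  have "poly.coeff p 0 = 0"
    using assms by (simp add: p_def c_def poly_0_coeff_0)
  then obtain q where q: "p = pCons 0 q"
    by (metis pCons_cases coeff_pCons_0)
  have "degree p \<le> Suc (Suc n)"
    unfolding p_def
    by (intro degree_diff_le order_trans[OF degree_smult_le])
      (auto intro: order_trans[OF degree_pCons_le])
  then have deg: "degree q \<le> Suc n"
    by (auto simp: q degree_pCons_eq_if split: if_splits)
  have "poly.coeff p (Suc (Suc n)) = 0"
    by (simp add: p_def k_def coeff_eq_0)
  then have "poly.coeff q (Suc n) = 0"
    by (simp add: q)
  with deg have deg: "degree q \<le> n"
    by (metis eq_zero_or_degree_less degree_0 le0 less_Suc_eq_le)
  have "pairing q r = 0" if r: "degree r < n" for r
  proof -
    have "pairing p (pCons 0 r) = 0"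
      using r by (simp add: p_def pairing_diff_left pairing_smult_left pairing_pCons_pCons
          pairing_phi_left coeff_eq_0 degree_pCons_eq_if)
    then show ?thesis
      by (simp add: q pairing_pCons_pCons)
  qed
  from orthogonal_imp_smult_phi[OF deg this]
  obtain d where d: "q = Polynomial.smult d (\<phi> n)" by blast
  have "\<phi> (Suc (Suc n)) = [:c, k:] * \<phi> (Suc n) - Polynomial.smult (- d) (pCons 0 (\<phi> n))"
    using q d by (simp add: p_def algebra_simps)
  then show thesis
    unfolding c_def k_def recurrence_factor_def[symmetric] by (rule that)
qed

section \<open>Functions of the second kind\<close>

definition stieltjes :: "complex poly \<Rightarrow> complex \<Rightarrow> complex" where
  "stieltjes p z = 2 * moment (\<lambda>\<zeta>. \<zeta> / (\<zeta> - z) * poly p \<zeta>)"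

lemma continuous_on_cauchy_kernel:
  fixes z :: complex
  assumes "norm z \<noteq> 1" "continuous_on (sphere 0 1) g"
  shows "continuous_on (sphere 0 1) (\<lambda>\<zeta>. g \<zeta> / (\<zeta> - z))"
  by (intro continuous_intros assms) (use assms in auto)

lemma stieltjes_add:
  assumes "norm z \<noteq> 1"
  shows "stieltjes (p + q) z = stieltjes p z + stieltjes q z"
  unfolding stieltjes_def poly_add distrib_left
  by (subst moment_add) (auto intro!: continuous_intros continuous_on_cauchy_kernel assms)

lemma stieltjes_smult: "stieltjes (Polynomial.smult c p) z = c * stieltjes p z"
  by (simp add: stieltjes_def moment_cmult[symmetric] algebra_simps)

text \<open>From \<zeta>^2/(\<zeta> - z) = \<zeta> + z \<zeta>/(\<zeta> - z): the transform turns
  multiplication by the variable into multiplication by z, up to a constant. Polynomial recurrences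
  therefore carry over once these constants cancel.\<close>

lemma stieltjes_pCons:
  assumes "norm z \<noteq> 1"
  shows "stieltjes (pCons 0 p) z = 2 * moment (\<lambda>\<zeta>. \<zeta> * poly p \<zeta>) + z * stieltjes p z"
proof -
  have "moment (\<lambda>\<zeta>. \<zeta> / (\<zeta> - z) * poly (pCons 0 p) \<zeta>) =
      moment (\<lambda>\<zeta>. \<zeta> * poly p \<zeta> + z * (\<zeta> / (\<zeta> - z) * poly p \<zeta>))"
  proof (rule moment_cong)
    fix \<zeta> :: complex assume "norm \<zeta> = 1"
    with assms have "\<zeta> \<noteq> z" by auto
    then show "\<zeta> / (\<zeta> - z) * poly (pCons 0 p) \<zeta> =
        \<zeta> * poly p \<zeta> + z * (\<zeta> / (\<zeta> - z) * poly p \<zeta>)"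
      by (simp add: field_simps)
  qed
  also have "\<dots> = moment (\<lambda>\<zeta>. \<zeta> * poly p \<zeta>) + z * moment (\<lambda>\<zeta>. \<zeta> / (\<zeta> - z) * poly p \<zeta>)"
    unfolding moment_cmult[symmetric]
    by (intro moment_add continuous_intros continuous_on_cauchy_kernel assms)
  finally show ?thesis
    by (simp add: stieltjes_def algebra_simps)
qed

lemma moment_phi: "n > 0 \<Longrightarrow> moment (poly (\<phi> n)) = 0"
  using pairing_phi_left[of 1 n] by (simp add: pairing_def)

text \<open>The kernels differ by the constant 1, since (\<zeta> + z)/(\<zeta> - z) =
  2\<zeta>/(\<zeta> - z) - 1. Its contribution vanishes by orthogonality for n > 0, and is
  compensated by the separate term \<open>fourier w 0\<close> for n = 0.\<close>

lemma eps_eq_stieltjes: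
  assumes "norm z \<noteq> 1"
  shows "eps w \<phi> n z = stieltjes (\<phi> n) z"
proof -
  have "circle_mean (\<lambda>\<zeta>. (\<zeta> + z) / (\<zeta> - z) * w \<zeta> * poly p \<zeta>) =
      stieltjes p z - moment (poly p)" for p
  proof -
    have "circle_mean (\<lambda>\<zeta>. (\<zeta> + z) / (\<zeta> - z) * w \<zeta> * poly p \<zeta>) =
        moment (\<lambda>\<zeta>. 2 * (\<zeta> / (\<zeta> - z) * poly p \<zeta>) - poly p \<zeta>)"
      unfolding moment_def
    proof (rule circle_mean_cong)
      fix \<zeta> :: complex assume "norm \<zeta> = 1"
      with assms have "\<zeta> \<noteq> z" by auto
      then show "(\<zeta> + z) / (\<zeta> - z) * w \<zeta> * poly p \<zeta> =
          w \<zeta> * (2 * (\<zeta> / (\<zeta> - z) * poly p \<zeta>) - poly p \<zeta>)"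
        by (simp add: divide_simps) (simp add: algebra_simps)
    qed
    then show ?thesis
      unfolding stieltjes_def moment_cmult[symmetric]
      by (subst moment_diff[symmetric])
        (auto intro!: continuous_intros continuous_on_cauchy_kernel assms)
  qed
  note * = this
  show ?thesis
  proof (cases "n = 0")
    case True
    have 0: "\<phi> 0 = [:\<kappa> 0:]"
      using degree_phi(1)[of 0] coeff_phi(1)[of 0] by (metis degree_0_id)
    have "caratheodory_fun w z = stieltjes 1 z - moment (poly 1)"
      using *[of 1] by (simp add: caratheodory_fun_def)
    moreover have "fourier w 0 = moment (poly 1)"
      by (simp add: fourier_def moment_def)
    moreover have "stieltjes (\<phi> 0) z = \<kappa> 0 * stieltjes 1 z"
      using 0 by (simp flip: stieltjes_smult)
    ultimately show ?thesis
      using True by (simp add: eps_def poly_1_eq)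
  next
    case False
    then show ?thesis
      using *[of "\<phi> n"] by (simp add: eps_def moment_phi)
  qed
qed

text \<open>The same argument as for \<open>eps\<close>, with the kernel written as 2z/(\<zeta> - z)
  + 1.\<close>

lemma eps_star_eq_moment:
  assumes "norm z \<noteq> 1"
  shows "eps_star w \<phi>b n z =
    - 2 * z ^ Suc n * moment (\<lambda>\<zeta>. poly (\<phi>b n) (inverse \<zeta>) / (\<zeta> - z))"
proof -
  have "circle_mean (\<lambda>\<zeta>. (\<zeta> + z) / (\<zeta> - z) * w \<zeta> * poly p (cnj \<zeta>)) =
      2 * z * moment (\<lambda>\<zeta>. poly p (inverse \<zeta>) / (\<zeta> - z)) + moment (\<lambda>\<zeta>. poly p (inverse \<zeta>))" for p
  proof -
    have "circle_mean (\<lambda>\<zeta>. (\<zeta> + z) / (\<zeta> - z) * w \<zeta> * poly p (cnj \<zeta>)) =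
        moment (\<lambda>\<zeta>. 2 * z * (poly p (inverse \<zeta>) / (\<zeta> - z)) + poly p (inverse \<zeta>))"
      unfolding moment_def
    proof (rule circle_mean_cong)
      fix \<zeta> :: complex assume n: "norm \<zeta> = 1"
      with assms have "\<zeta> \<noteq> z" by auto
      then show "(\<zeta> + z) / (\<zeta> - z) * w \<zeta> * poly p (cnj \<zeta>) =
          w \<zeta> * (2 * z * (poly p (inverse \<zeta>) / (\<zeta> - z)) + poly p (inverse \<zeta>))"
        unfolding inverse_eq_cnj[OF n]
        by (simp add: divide_simps) (simp add: algebra_simps)
    qed
    then show ?thesis
      unfolding moment_cmult[symmetric]
      by (subst moment_add[symmetric])
        (auto intro!: continuous_intros continuous_on_cauchy_kernel assms)
  qed
  note * = this
  show ?thesis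
  proof (cases "n = 0")
    case True
    have 0: "\<phi>b 0 = [:\<kappa> 0:]"
      using degree_phi(2)[of 0] coeff_phi(2)[of 0] by (metis degree_0_id)
    have "caratheodory_fun w z = 2 * z * moment (\<lambda>\<zeta>. 1 / (\<zeta> - z)) + moment (poly 1)"
      using *[of 1] by (simp add: caratheodory_fun_def poly_1_eq)
    moreover have "fourier w 0 = moment (poly 1)"
      by (simp add: fourier_def moment_def)
    moreover have "moment (\<lambda>\<zeta>. \<kappa> 0 / (\<zeta> - z)) = \<kappa> 0 * moment (\<lambda>\<zeta>. 1 / (\<zeta> - z))"
      using moment_cmult[of "\<kappa> 0" "\<lambda>\<zeta>. 1 / (\<zeta> - z)"] by simp
    ultimately show ?thesis
      using True by (simp add: eps_star_def 0 poly_1_eq)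
  next
    case False
    then have "moment (\<lambda>\<zeta>. poly (\<phi>b n) (inverse \<zeta>)) = 0"
      using pairing_phib_right[of 1 n] by (simp add: pairing_def)
    with False show ?thesis
      using *[of "\<phi>b n"] by (simp add: eps_star_def)
  qed
qed

text \<open>Dividing \<zeta>^(n+1) by \<zeta> - z leaves a monic quotient of degree n in \<zeta>,
  which pairs with \<open>\<phi>b n\<close> to 1 / \<open>\<kappa> n\<close>, and the remainder
  z^(n+1), which gives the starred function.\<close>

lemma stieltjes_reflect:
  assumes "norm z \<noteq> 1"
  shows "stieltjes (reflect_poly (\<phi>b n)) z = 2 / \<kappa> n - eps_star w \<phi>b n z"
proof -
  define p where "p = (\<Sum>i\<le>n. Polynomial.monom (z ^ (n - i)) i)"
  have "moment (\<lambda>\<zeta>. \<zeta> / (\<zeta> - z) * poly (reflect_poly (\<phi>b n)) \<zeta>) =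
      moment (\<lambda>\<zeta>. poly p \<zeta> * poly (\<phi>b n) (inverse \<zeta>)
        + z ^ Suc n * (poly (\<phi>b n) (inverse \<zeta>) / (\<zeta> - z)))"
  proof (rule moment_cong)
    fix \<zeta> :: complex assume n: "norm \<zeta> = 1"
    then have z: "\<zeta> \<noteq> z" "\<zeta> \<noteq> 0" using assms by auto
    have "\<zeta> ^ Suc n - z ^ Suc n = (\<zeta> - z) * poly p \<zeta>"
      unfolding power_diff_sumr2[of \<zeta> "Suc n" z] lessThan_Suc_atMost
      by (simp add: p_def poly_sum poly_monom)
    then have "\<zeta> ^ Suc n / (\<zeta> - z) = poly p \<zeta> + z ^ Suc n / (\<zeta> - z)"
      using z by (simp add: divide_simps) (simp add: algebra_simps)
    then have "\<zeta> ^ Suc n / (\<zeta> - z) * poly (\<phi>b n) (inverse \<zeta>) =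
        (poly p \<zeta> + z ^ Suc n / (\<zeta> - z)) * poly (\<phi>b n) (inverse \<zeta>)"
      by simp
    with z show "\<zeta> / (\<zeta> - z) * poly (reflect_poly (\<phi>b n)) \<zeta> =
        poly p \<zeta> * poly (\<phi>b n) (inverse \<zeta>) + z ^ Suc n * (poly (\<phi>b n) (inverse \<zeta>) / (\<zeta> - z))"
      by (simp add: poly_reflect_poly_nz distrib_right mult.assoc)
  qed
  also have "\<dots> = pairing p (\<phi>b n)
      + z ^ Suc n * moment (\<lambda>\<zeta>. poly (\<phi>b n) (inverse \<zeta>) / (\<zeta> - z))"
    unfolding moment_cmult[symmetric] pairing_def
    by (intro moment_add continuous_intros continuous_on_cauchy_kernel assms)
  also have "degree p \<le> n"
    unfolding p_def by (intro degree_sum_le) (auto intro: order_trans[OF degree_monom_le])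
  then have "pairing p (\<phi>b n) = 1 / \<kappa> n"
    by (simp add: pairing_phib_right p_def coeff_sum)
  finally show ?thesis
    by (simp add: stieltjes_def eps_star_eq_moment[OF assms] algebra_simps)
qed

text \<open>The Stieltjes transform of the Szego recurrence; the additive constants cancel by
  \<open>phi_Suc_at_0\<close>.\<close>

lemma eps_Suc:
  assumes "norm z \<noteq> 1"
  shows "\<kappa> n * eps w \<phi> (Suc n) z =
    \<kappa> (Suc n) * z * eps w \<phi> n z - poly (\<phi> (Suc n)) 0 * eps_star w \<phi>b n z"
proof -
  have "\<kappa> n * eps w \<phi> (Suc n) z = stieltjes (Polynomial.smult (\<kappa> n) (\<phi> (Suc n))) z"
    by (simp add: eps_eq_stieltjes[OF assms] stieltjes_smult)
  also have "\<dots> = \<kappa> (Suc n) * z * eps w \<phi> n z - poly (\<phi> (Suc n)) 0 * eps_star w \<phi>b n z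
      + 2 * (\<kappa> (Suc n) * first_moment n + poly (\<phi> (Suc n)) 0 / \<kappa> n)"
    unfolding phi_Suc stieltjes_add[OF assms] stieltjes_smult stieltjes_pCons[OF assms]
      stieltjes_reflect[OF assms]
    by (simp add: eps_eq_stieltjes[OF assms] first_moment_def algebra_simps)
  finally show ?thesis
    by (simp add: phi_Suc_at_0)
qed

end

section \<open>Tools: exceptional points, local branches, limits at infinity\<close>

lemma poly_eqI_off_circle:
  fixes p q W :: "complex poly"
  assumes "W \<noteq> 0" "\<And>z. norm z \<noteq> 1 \<Longrightarrow> poly W z \<noteq> 0 \<Longrightarrow> z \<noteq> 0 \<Longrightarrow> poly p z = poly q z"
  shows "p = q"
proof (rule ccontr)
  assume "p \<noteq> q"
  \<comment> \<open>The extra factors W and z make the product vanish at the excluded points as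
    well, so it is zero on the whole open disc.\<close>
  then have "W * (p - q) * [:0, 1:] \<noteq> 0" using assms(1) by auto
  then have "finite {z. poly (W * (p - q) * [:0, 1:]) z = 0}"
    by (rule poly_roots_finite)
  moreover have "ball 0 1 \<subseteq> {z. poly (W * (p - q) * [:0, 1:]) z = 0}"
  proof
    fix z :: complex assume "z \<in> ball 0 1"
    then have "norm z \<noteq> 1" by simp
    then show "z \<in> {z. poly (W * (p - q) * [:0, 1:]) z = 0}"
      using assms(2)[of z] by auto
  qed
  moreover have "infinite (ball (0::complex) 1)"
    using uncountable_ball[of 1 "0::complex"] by (auto dest: countable_finite)
  ultimately show False
    using finite_subset by blast
qed

text \<open>On a small disc D/W has a primitive, and its exponential solves v'/v = D/W. This
  supplies the branch needed to apply \<open>spectral_coefficients\<close>.\<close>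

lemma local_branch:
  fixes W D :: "complex poly"
  assumes "norm z \<noteq> 1" "poly W z \<noteq> 0"
  obtains S v where "open S" "z \<in> S" "S \<inter> sphere 0 1 = {}"
    "\<forall>y\<in>S. poly W y \<noteq> 0 \<and> v y \<noteq> 0 \<and> (v has_field_derivative poly D y / poly W y * v y) (at y)"
proof -
  have "open ({y. poly W y \<noteq> 0} \<inter> - sphere 0 1)"
    by (intro open_Int open_Collect_neq continuous_intros) auto
  moreover have "z \<in> {y. poly W y \<noteq> 0} \<inter> - sphere 0 1"
    using assms by auto
  ultimately obtain r where r: "r > 0" "ball z r \<subseteq> {y. poly W y \<noteq> 0} \<inter> - sphere 0 1"
    by (meson open_contains_ball)
  then have "(\<lambda>y. poly D y / poly W y) holomorphic_on ball z r"
    by (intro holomorphic_intros) auto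
  then obtain G where G: "\<And>y. y \<in> ball z r \<Longrightarrow>
      (G has_field_derivative poly D y / poly W y) (at y within ball z r)"
    using holomorphic_convex_primitive'[OF convex_ball open_ball] by blast
  have "((\<lambda>y. exp (G y)) has_field_derivative poly D y / poly W y * exp (G y)) (at y)"
    if "y \<in> ball z r" for y
    using G[OF that] that
    by (auto simp: at_within_open[OF _ open_ball] mult.commute intro!: derivative_eq_intros)
  with r show thesis
    by (intro that[of "ball z r" "\<lambda>y. exp (G y)"]) auto
qed

lemma isCont_eventually_0:
  fixes f :: "complex \<Rightarrow> complex"
  assumes "isCont f a" "\<forall>\<^sub>F z in at a. f z = 0"
  shows "f a = 0"
proof -
  have "(f \<longlongrightarrow> 0) (at a)"
    by (rule tendsto_eventually[OF assms(2)])
  with assms(1) show ?thesis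
    using LIM_unique isContD by blast
qed

lemma tendsto_poly_over_power:
  fixes p :: "complex poly"
  assumes "degree p \<le> m"
  shows "((\<lambda>z. poly p z / z ^ m) \<longlongrightarrow> poly.coeff p m) at_infinity"
proof -
  have lim: "((\<lambda>z::complex. inverse z ^ k) \<longlongrightarrow> 0 ^ k) at_infinity" for k
    by (intro tendsto_power tendsto_inverse_0)
  have "((\<lambda>z. poly p z / z ^ degree p * inverse z ^ (m - degree p))
      \<longlongrightarrow> lead_coeff p * 0 ^ (m - degree p)) at_infinity"
    by (intro tendsto_mult poly_divide_tendsto_aux lim)
  moreover have "lead_coeff p * 0 ^ (m - degree p) = poly.coeff p m"
    using assms by (cases "degree p = m") (auto simp: coeff_eq_0)
  moreover have "poly p z / z ^ degree p * inverse z ^ (m - degree p) = poly p z / z ^ m" for z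
    using assms
    by (simp add: divide_inverse mult.assoc flip: power_inverse power_add)
  ultimately show ?thesis by simp
qed

text \<open>If the degree exceeded m, the quotient by \<open>z ^ degree p\<close> would tend both to
  the leading coefficient and to 0. This reads degree bounds and top coefficients off growth at
  infinity.\<close>

lemma degree_coeff_of_tendsto:
  fixes p :: "complex poly"
  assumes "((\<lambda>z. poly p z / z ^ m) \<longlongrightarrow> c) at_infinity"
  shows "degree p \<le> m" "poly.coeff p m = c"
proof -
  show deg: "degree p \<le> m"
  proof (rule ccontr)
    assume *: "\<not> degree p \<le> m"
    have "((\<lambda>z. poly p z / z ^ m * inverse z ^ (degree p - m)) \<longlongrightarrow> c * 0 ^ (degree p - m))
        at_infinity"
      by (intro tendsto_mult assms tendsto_power tendsto_inverse_0)
    moreover have "poly p z / z ^ m * inverse z ^ (degree p - m) = poly p z / z ^ degree p" for z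
      using * by (simp add: divide_inverse mult.assoc flip: power_inverse power_add)
    ultimately have "((\<lambda>z. poly p z / z ^ degree p) \<longlongrightarrow> 0) at_infinity"
      using * by (simp add: power_0_left)
    then have "lead_coeff p = 0"
      using poly_divide_tendsto_aux tendsto_unique trivial_limit_at_infinity by blast
    with * show False by simp
  qed
  show "poly.coeff p m = c"
    using tendsto_poly_over_power[OF deg] assms tendsto_unique trivial_limit_at_infinity by blast
qed

section \<open>Expansions at 0 and infinity, and the Casoratian\<close>

context biorthogonal_polynomials
begin

text \<open>The holomorphic factor left in \<open>eps\<close> near 0 after splitting off 2
  z^n.\<close>

definition inner_part :: "nat \<Rightarrow> complex \<Rightarrow> complex" where
  "inner_part n = resolvent inverse (\<lambda>\<zeta>. poly (\<phi> n) \<zeta> * inverse \<zeta> ^ n)"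

text \<open>The corresponding factor near infinity, in the variable 1/z, after splitting off
  -2/z.\<close>

definition outer_part :: "nat \<Rightarrow> complex \<Rightarrow> complex" where
  "outer_part n = resolvent (\<lambda>\<zeta>. \<zeta>) (\<lambda>\<zeta>. \<zeta> * poly (\<phi> n) \<zeta>)"

lemma holomorphic_inner_part: "inner_part n holomorphic_on ball 0 1"
  unfolding inner_part_def
  by (rule holomorphic_resolvent) (auto intro!: continuous_intros simp: norm_inverse)

lemma holomorphic_outer_part: "outer_part n holomorphic_on ball 0 1"
  unfolding outer_part_def
  by (rule holomorphic_resolvent) (auto intro!: continuous_intros)

lemma inner_part_0: "inner_part n 0 = 1 / \<kappa> n"
  using pairing_phi_left[of "Polynomial.monom 1 n" n]
  by (simp add: inner_part_def resolvent_def pairing_def poly_monom degree_monom_eq)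

lemma outer_part_0: "outer_part n 0 = first_moment n"
  by (simp add: outer_part_def resolvent_def first_moment_def)

lemma stieltjes_inner:
  assumes "norm z < 1"
  shows "stieltjes p z = 2 * resolvent inverse (poly p) z"
proof -
  have "moment (\<lambda>\<zeta>. \<zeta> / (\<zeta> - z) * poly p \<zeta>) = resolvent inverse (poly p) z"
    unfolding resolvent_def
  proof (rule moment_cong)
    fix \<zeta> :: complex assume "norm \<zeta> = 1"
    then have "\<zeta> \<noteq> 0" "\<zeta> \<noteq> z" using assms by auto
    then show "\<zeta> / (\<zeta> - z) * poly p \<zeta> = poly p \<zeta> / (1 - inverse \<zeta> * z)"
      by (simp add: divide_simps)
  qed
  then show ?thesis by (simp add: stieltjes_def)
qed

text \<open>By orthogonality the first n moments in the geometric expansion vanish, so only the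
  remainder survives, with its factor z^n.\<close>

lemma eps_inner:
  assumes "norm z < 1"
  shows "eps w \<phi> n z = 2 * z ^ n * inner_part n z"
proof -
  have "moment (\<lambda>\<zeta>. poly (\<phi> n) \<zeta> * inverse \<zeta> ^ k) = 0" if "k < n" for k
    using pairing_phi_left[of "Polynomial.monom 1 k" n] that
    by (simp add: pairing_def poly_monom degree_monom_eq)
  then have "resolvent inverse (poly (\<phi> n)) z = z ^ n * inner_part n z"
    unfolding inner_part_def
    by (subst resolvent_partial_sum[of _ _ _ n])
      (use assms in \<open>auto intro!: continuous_intros simp: norm_inverse\<close>)
  then show ?thesis
    using assms by (simp add: eps_eq_stieltjes stieltjes_inner)
qed

lemma eps_outer:
  assumes "norm z > 1"
  shows "eps w \<phi> n z = - 2 / z * outer_part n (1 / z)"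
proof -
  have "moment (\<lambda>\<zeta>. \<zeta> / (\<zeta> - z) * poly (\<phi> n) \<zeta>) =
      moment (\<lambda>\<zeta>. - 1 / z * (\<zeta> * poly (\<phi> n) \<zeta> / (1 - \<zeta> * (1 / z))))"
  proof (rule moment_cong)
    fix \<zeta> :: complex assume "norm \<zeta> = 1"
    then have "z \<noteq> 0" "\<zeta> \<noteq> z" using assms by auto
    then show "\<zeta> / (\<zeta> - z) * poly (\<phi> n) \<zeta> =
        - 1 / z * (\<zeta> * poly (\<phi> n) \<zeta> / (1 - \<zeta> * (1 / z)))"
      by (simp add: divide_simps) (simp add: algebra_simps)
  qed
  then show ?thesis
    using assms
    by (simp only: moment_cmult eps_eq_stieltjes less_imp_neq[symmetric] not_False_eq_True)
      (simp add: stieltjes_def outer_part_def resolvent_def)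
qed

text \<open>Pairing the polynomial recurrence with 1 gives the relation between first moments. This
  is exactly what makes the additive constant in the transformed recurrence vanish.\<close>

lemma three_term_eps:
  assumes d: "\<phi> (Suc (Suc n)) =
    recurrence_factor n * \<phi> (Suc n) - Polynomial.smult d (pCons 0 (\<phi> n))"
  shows "d * first_moment n = \<kappa> (Suc (Suc n)) / \<kappa> (Suc n) * first_moment (Suc n)"
    and "norm z \<noteq> 1 \<Longrightarrow> eps w \<phi> (Suc (Suc n)) z =
      poly (recurrence_factor n) z * eps w \<phi> (Suc n) z - d * z * eps w \<phi> n z"
proof -
  obtain c k where ck: "recurrence_factor n = [:c, k:]" "k = \<kappa> (Suc (Suc n)) / \<kappa> (Suc n)"
    by (simp add: recurrence_factor_def)
  have d': "\<phi> (Suc (Suc n)) = Polynomial.smult c (\<phi> (Suc n))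
      + Polynomial.smult k (pCons 0 (\<phi> (Suc n))) + Polynomial.smult (- d) (pCons 0 (\<phi> n))"
    by (simp add: d ck(1))
  have "pairing (\<phi> (Suc (Suc n))) 1 = 0" "pairing (\<phi> (Suc n)) 1 = 0"
    by (simp_all add: pairing_phi_left)
  then have m: "d * first_moment n = k * first_moment (Suc n)"
    unfolding d' pairing_add_left pairing_smult_left
    by (simp add: first_moment_eq_pairing)
  then show "d * first_moment n = \<kappa> (Suc (Suc n)) / \<kappa> (Suc n) * first_moment (Suc n)"
    by (simp add: ck(2))
  assume z: "norm z \<noteq> 1"
  have "eps w \<phi> (Suc (Suc n)) z = (c + k * z) * eps w \<phi> (Suc n) z - d * z * eps w \<phi> n z
      + 2 * (k * first_moment (Suc n) - d * first_moment n)"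
    unfolding eps_eq_stieltjes[OF z] d' stieltjes_add[OF z] stieltjes_smult stieltjes_pCons[OF z]
    by (simp add: first_moment_def algebra_simps)
  with m show "eps w \<phi> (Suc (Suc n)) z =
      poly (recurrence_factor n) z * eps w \<phi> (Suc n) z - d * z * eps w \<phi> n z"
    by (simp add: ck(1) mult.commute)
qed

text \<open>Both sequences solve the same three-term recurrence, so each step multiplies the
  Casoratian by d z; the first relation of \<open>three_term_eps\<close> then eliminates d.\<close>

lemma casoratian:
  assumes "\<And>n. poly (\<phi> n) 0 \<noteq> 0" and z: "norm z \<noteq> 1"
  shows "poly (\<phi> (Suc n)) z * eps w \<phi> n z - poly (\<phi> n) z * eps w \<phi> (Suc n) z =
    - (2 * \<kappa> (Suc n) * first_moment n * z ^ n)"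
proof (induction n)
  case 0
  have [simp]: "\<phi> 0 = [:\<kappa> 0:]" "\<phi>b 0 = [:\<kappa> 0:]"
    using degree_phi[of 0] coeff_phi[of 0] by (metis degree_0_id)+
  \<comment> \<open>At level 0 the polynomial and its reflection are the same constant.\<close>
  have "eps_star w \<phi>b 0 z = 2 / \<kappa> 0 - eps w \<phi> 0 z"
    using stieltjes_reflect[OF z, of 0] eps_eq_stieltjes[OF z, of 0] by simp
  then have e1: "\<kappa> 0 * eps w \<phi> (Suc 0) z = \<kappa> 1 * z * eps w \<phi> 0 z
      - poly (\<phi> (Suc 0)) 0 * (2 / \<kappa> 0 - eps w \<phi> 0 z)"
    using eps_Suc[OF z, of 0] by simp
  have "\<kappa> 0 * poly (\<phi> (Suc 0)) z = poly (Polynomial.smult (\<kappa> 0) (\<phi> (Suc 0))) z"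
    by simp
  also have "\<dots> = \<kappa> 0 * (\<kappa> 1 * z + poly (\<phi> (Suc 0)) 0)"
    unfolding phi_Suc by (simp add: algebra_simps)
  finally have "poly (\<phi> (Suc 0)) z = \<kappa> 1 * z + poly (\<phi> (Suc 0)) 0"
    by simp
  then have "poly (\<phi> (Suc 0)) z * eps w \<phi> 0 z - \<kappa> 0 * eps w \<phi> (Suc 0) z
      = 2 / \<kappa> 0 * poly (\<phi> (Suc 0)) 0"
    unfolding e1 by (simp add: algebra_simps)
  then show ?case
    by (simp add: phi_Suc_at_0)
next
  case (Suc n)
  obtain d where d: "\<phi> (Suc (Suc n)) =
      recurrence_factor n * \<phi> (Suc n) - Polynomial.smult d (pCons 0 (\<phi> n))"
    using three_term assms(1) by blast
  have p: "poly (\<phi> (Suc (Suc n))) z =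
      poly (recurrence_factor n) z * poly (\<phi> (Suc n)) z - d * z * poly (\<phi> n) z"
    unfolding d by simp
  have "poly (\<phi> (Suc (Suc n))) z * eps w \<phi> (Suc n) z
        - poly (\<phi> (Suc n)) z * eps w \<phi> (Suc (Suc n)) z =
      d * z * (poly (\<phi> (Suc n)) z * eps w \<phi> n z - poly (\<phi> n) z * eps w \<phi> (Suc n) z)"
    unfolding p three_term_eps(2)[OF d z] by (simp add: algebra_simps)
  also have "\<dots> = - (2 * \<kappa> (Suc n) * (d * first_moment n) * z ^ Suc n)"
    unfolding Suc.IH by simp
  also have "\<dots> = - (2 * \<kappa> (Suc (Suc n)) * first_moment (Suc n) * z ^ Suc n)"
    unfolding three_term_eps(1)[OF d] by simp
  finally show ?case .
qed

end

section \<open>The spectral equations\<close>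

locale spectral_system = biorthogonal_polynomials +
  fixes W D :: "complex poly" and \<Theta> \<Omega> \<Theta>s \<Omega>s :: "nat \<Rightarrow> complex poly"
  assumes W_nonzero: "W \<noteq> 0"
    and reflection: "\<And>n. poly (\<phi> n) 0 \<noteq> 0"
    and spectral: "\<And>n. spectral_coefficients W D w \<phi> \<phi>b n (\<Theta> n) (\<Omega> n) (\<Theta>s n) (\<Omega>s n)"
begin

section \<open>Scalar form of the spectral equation\<close>

lemma first_moment_nonzero: "first_moment n \<noteq> 0"
  using phi_Suc_at_0[of n] reflection[of "Suc n"] by auto

text \<open>The first row of Y' = A Y for a local branch v. In the second column, multiplying by v
  removes the branch and adds the term with D.\<close>

lemma spectral_rows:
  fixes n z
  assumes z: "norm z \<noteq> 1" "poly W z \<noteq> 0"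
  defines "a \<equiv> - (poly (\<Omega> n) z + poly D z / 2 - \<kappa> (Suc n) / \<kappa> n * z * poly (\<Theta> n) z)"
    and "b \<equiv> poly (\<phi> (Suc n)) 0 / \<kappa> n * poly (\<Theta> n) z"
  shows "poly W z * poly (pderiv (\<phi> n)) z =
      a * poly (\<phi> n) z + b * poly (reflect_poly (\<phi>b n)) z"
    and "(eps w \<phi> n has_field_derivative
      (a * eps w \<phi> n z - b * eps_star w \<phi>b n z + poly D z * eps w \<phi> n z) / poly W z) (at z)"
proof -
  obtain S v where S: "open S" "z \<in> S" "S \<inter> sphere 0 1 = {}"
    and v: "\<forall>y\<in>S. poly W y \<noteq> 0 \<and> v y \<noteq> 0 \<and>
      (v has_field_derivative poly D y / poly W y * v y) (at y)"
    using local_branch[OF z] by blast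
  have Y: "Y_mat w \<phi> \<phi>b v n u $$ (0, 0) = poly (\<phi> n) u"
      "Y_mat w \<phi> \<phi>b v n u $$ (0, Suc 0) = eps w \<phi> n u / v u" for u
    by (simp_all add: Y_mat_def mat_of_rows_list_def)
  have AY: "(A_mat W D \<phi> \<phi>b n (\<Theta> n) (\<Omega> n) (\<Theta>s n) (\<Omega>s n) z * Y_mat w \<phi> \<phi>b v n z) $$ (0, 0)
        = (a * poly (\<phi> n) z + b * poly (reflect_poly (\<phi>b n)) z) / poly W z"
      "(A_mat W D \<phi> \<phi>b n (\<Theta> n) (\<Omega> n) (\<Theta>s n) (\<Omega>s n) z * Y_mat w \<phi> \<phi>b v n z) $$ (0, Suc 0)
        = (a * (eps w \<phi> n z / v z) - b * (eps_star w \<phi>b n z / v z)) / poly W z"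
    by (simp_all add: Y_mat_def A_mat_def mat_of_rows_list_def Let_def scalar_prod_def a_def b_def
        add_divide_distrib diff_divide_distrib)
  have der: "((\<lambda>u. Y_mat w \<phi> \<phi>b v n u $$ (0, j)) has_field_derivative
      (A_mat W D \<phi> \<phi>b n (\<Theta> n) (\<Omega> n) (\<Theta>s n) (\<Omega>s n) z * Y_mat w \<phi> \<phi>b v n z) $$ (0, j)) (at z)"
    if "j < 2" for j
    using spectral[of n] S v that unfolding spectral_coefficients_def by force
  have "poly (pderiv (\<phi> n)) z = (a * poly (\<phi> n) z + b * poly (reflect_poly (\<phi>b n)) z) / poly W z"
    using der[of 0] unfolding Y AY by (auto intro: DERIV_unique poly_DERIV)
  then show "poly W z * poly (pderiv (\<phi> n)) z =
      a * poly (\<phi> n) z + b * poly (reflect_poly (\<phi>b n)) z"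
    using z by simp
  have "((\<lambda>u. eps w \<phi> n u / v u) has_field_derivative
      (a * (eps w \<phi> n z / v z) - b * (eps_star w \<phi>b n z / v z)) / poly W z) (at z)"
    using der[of "Suc 0"] unfolding Y AY by simp
  then have "((\<lambda>u. eps w \<phi> n u / v u * v u) has_field_derivative
      (a * (eps w \<phi> n z / v z) - b * (eps_star w \<phi>b n z / v z)) / poly W z * v z
        + poly D z / poly W z * v z * (eps w \<phi> n z / v z)) (at z)"
    using S v by (intro DERIV_mult) auto
  moreover have "(a * (eps w \<phi> n z / v z) - b * (eps_star w \<phi>b n z / v z)) / poly W z * v z
        + poly D z / poly W z * v z * (eps w \<phi> n z / v z)
      = (a * eps w \<phi> n z - b * eps_star w \<phi>b n z + poly D z * eps w \<phi> n z) / poly W z"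
    using S v by (simp add: field_simps)
  ultimately show "(eps w \<phi> n has_field_derivative
      (a * eps w \<phi> n z - b * eps_star w \<phi>b n z + poly D z * eps w \<phi> n z) / poly W z) (at z)"
    using S v by (auto elim!: has_field_derivative_transform_within_open)
qed

text \<open>The Szego recurrence trades the reflected polynomial for \<open>\<phi> (Suc n)\<close>.
  Being a polynomial identity, the result also holds at the zeros of W, where it is used
  later.\<close>

lemma pderiv_phi:
  "W * pderiv (\<phi> n) = \<Theta> n * \<phi> (Suc n) - (\<Omega> n + Polynomial.smult (1/2) D) * \<phi> n"
proof (rule poly_eqI_off_circle[OF W_nonzero])
  fix z :: complex assume z: "norm z \<noteq> 1" "poly W z \<noteq> 0"
  have "\<kappa> n * poly (\<phi> (Suc n)) z = poly (Polynomial.smult (\<kappa> n) (\<phi> (Suc n))) z"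
    by simp
  also have "\<dots> = \<kappa> (Suc n) * z * poly (\<phi> n) z
      + poly (\<phi> (Suc n)) 0 * poly (reflect_poly (\<phi>b n)) z"
    unfolding phi_Suc by simp
  finally have "poly (\<phi> (Suc n)) z = \<kappa> (Suc n) / \<kappa> n * z * poly (\<phi> n) z
      + poly (\<phi> (Suc n)) 0 / \<kappa> n * poly (reflect_poly (\<phi>b n)) z"
    by (simp add: field_simps)
  then show "poly (W * pderiv (\<phi> n)) z =
      poly (\<Theta> n * \<phi> (Suc n) - (\<Omega> n + Polynomial.smult (1/2) D) * \<phi> n) z"
    using spectral_rows(1)[OF z, of n] by (simp add: algebra_simps)
qed

text \<open>The starred function is eliminated by \<open>eps_Suc\<close>. The added term with D
  turns \<Omega> + D/2 into \<Omega> - D/2.\<close>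

lemma deriv_eps:
  assumes z: "norm z \<noteq> 1" "poly W z \<noteq> 0"
  shows "(eps w \<phi> n has_field_derivative
    (poly (\<Theta> n) z * eps w \<phi> (Suc n) z - (poly (\<Omega> n) z - poly D z / 2) * eps w \<phi> n z)
      / poly W z) (at z)"
proof -
  have s: "eps w \<phi> (Suc n) z = \<kappa> (Suc n) / \<kappa> n * z * eps w \<phi> n z
      - poly (\<phi> (Suc n)) 0 / \<kappa> n * eps_star w \<phi>b n z"
    using eps_Suc[OF z(1), of n] by (simp add: field_simps)
  have e: "poly (\<Theta> n) z * eps w \<phi> (Suc n) z =
      \<kappa> (Suc n) / \<kappa> n * z * poly (\<Theta> n) z * eps w \<phi> n z
      - poly (\<phi> (Suc n)) 0 / \<kappa> n * poly (\<Theta> n) z * eps_star w \<phi>b n z"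
    unfolding s by (simp add: algebra_simps)
  show ?thesis
    using spectral_rows(2)[OF z, of n] unfolding e by (simp add: algebra_simps)
qed

section \<open>Relations between neighbouring levels\<close>

lemma three_term_system:
  obtains d where "d \<noteq> 0"
    and "\<And>z. poly (\<phi> (Suc (Suc n))) z =
      poly (recurrence_factor n) z * poly (\<phi> (Suc n)) z - d * z * poly (\<phi> n) z"
    and "\<And>z. norm z \<noteq> 1 \<Longrightarrow> eps w \<phi> (Suc (Suc n)) z =
      poly (recurrence_factor n) z * eps w \<phi> (Suc n) z - d * z * eps w \<phi> n z"
proof -
  obtain d where d: "\<phi> (Suc (Suc n)) =
      recurrence_factor n * \<phi> (Suc n) - Polynomial.smult d (pCons 0 (\<phi> n))"
    using three_term reflection by blast
  have "d \<noteq> 0"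
    using three_term_eps(1)[OF d] first_moment_nonzero[of "Suc n"] by auto
  moreover have "poly (\<phi> (Suc (Suc n))) z =
      poly (recurrence_factor n) z * poly (\<phi> (Suc n)) z - d * z * poly (\<phi> n) z" for z
    unfolding d by simp
  ultimately show thesis
    using three_term_eps(2)[OF d] by (rule that)
qed

text \<open>Since d z is nonzero, a common root would descend through the recurrence to the nonzero
  constant \<open>\<phi> 0\<close>.\<close>

lemma phi_no_common_root:
  assumes "z \<noteq> 0"
  shows "poly (\<phi> n) z \<noteq> 0 \<or> poly (\<phi> (Suc n)) z \<noteq> 0"
proof (induction n)
  case 0
  have "\<phi> 0 = [:\<kappa> 0:]"
    using degree_phi(1)[of 0] coeff_phi(1)[of 0] by (metis degree_0_id)
  then have "poly (\<phi> 0) z \<noteq> 0" by simp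
  then show ?case by simp
next
  case (Suc n)
  obtain d where d: "d \<noteq> 0" and "\<And>z. poly (\<phi> (Suc (Suc n))) z =
      poly (recurrence_factor n) z * poly (\<phi> (Suc n)) z - d * z * poly (\<phi> n) z"
    using three_term_system[of n] by metis
  from this(2)[of z] have "poly (\<phi> (Suc (Suc n))) z = - (d * z * poly (\<phi> n) z)"
    if "poly (\<phi> (Suc n)) z = 0"
    by (simp only: that mult_zero_right diff_0)
  with d Suc assms show ?case by fastforce
qed

text \<open>The Casoratian X is a nonzero constant times z^n, so z X' = n X. Computing W X' from the
  derivative equations cancels D and again gives a multiple of X, which is then divided out.\<close>

lemma Omega_add:
  assumes W: "W = pCons 0 W1"
  shows "Polynomial.smult (of_nat n) W1 =
    recurrence_factor n * \<Theta> (Suc n) - (\<Omega> (Suc n) + \<Omega> n)"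
proof -
  obtain d where
    phi2: "\<And>z. poly (\<phi> (Suc (Suc n))) z =
      poly (recurrence_factor n) z * poly (\<phi> (Suc n)) z - d * z * poly (\<phi> n) z"
    and eps2: "\<And>z. norm z \<noteq> 1 \<Longrightarrow>
      eps w \<phi> (Suc (Suc n)) z = poly (recurrence_factor n) z * eps w \<phi> (Suc n) z - d * z * eps w \<phi> n z"
    using three_term_system[of n] by metis
  have "Polynomial.smult (of_nat n) W1 = recurrence_factor n * \<Theta> (Suc n) - (\<Omega> (Suc n) + \<Omega> n)"
  proof (rule poly_eqI_off_circle[OF W_nonzero])
    fix z :: complex assume z: "norm z \<noteq> 1" "poly W z \<noteq> 0" "z \<noteq> 0"
    define C where "C = - (2 * \<kappa> (Suc n) * first_moment n)"
    have C: "C \<noteq> 0" by (simp add: C_def first_moment_nonzero)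
    define X where "X u = poly (\<phi> (Suc n)) u * eps w \<phi> n u - poly (\<phi> n) u * eps w \<phi> (Suc n) u" for u
    have X: "X u = C * u ^ n" if "norm u \<noteq> 1" for u
      unfolding X_def casoratian[OF reflection that] C_def by simp
    define L where "L = poly (pderiv (\<phi> (Suc n))) z * eps w \<phi> n z
      + (poly (\<Theta> n) z * eps w \<phi> (Suc n) z - (poly (\<Omega> n) z - poly D z / 2) * eps w \<phi> n z)
          / poly W z * poly (\<phi> (Suc n)) z
      - (poly (pderiv (\<phi> n)) z * eps w \<phi> (Suc n) z
      + (poly (\<Theta> (Suc n)) z * eps w \<phi> (Suc (Suc n)) z
          - (poly (\<Omega> (Suc n)) z - poly D z / 2) * eps w \<phi> (Suc n) z) / poly W z * poly (\<phi> n) z)"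
    have "(X has_field_derivative L) (at z)"
      unfolding X_def L_def
      by (intro DERIV_diff DERIV_mult poly_DERIV deriv_eps z)
    then have "((\<lambda>u. C * u ^ n) has_field_derivative L) (at z)"
      by (rule has_field_derivative_transform_within_open[where S = "- sphere 0 1"])
        (use z X in auto)
    moreover have "((\<lambda>u. C * u ^ n) has_field_derivative C * (of_nat n * z ^ (n - 1))) (at z)"
      by (auto intro!: derivative_eq_intros)
    ultimately have "L = C * (of_nat n * z ^ (n - 1))"
      by (rule DERIV_unique)
    \<comment> \<open>Multiplication by z also settles n = 0, where the exponent n - 1 is
      truncated.\<close>
    then have "z * L = of_nat n * X z"
      using X[OF z(1)] by (cases n) auto
    then have 1: "poly W z * L = poly W1 z * of_nat n * X z"
      by (simp add: W)
    have pd: "poly W z * poly (pderiv (\<phi> m)) z =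
        poly (\<Theta> m) z * poly (\<phi> (Suc m)) z - (poly (\<Omega> m) z + poly D z / 2) * poly (\<phi> m) z" for m
      using arg_cong[OF pderiv_phi[of m], of "\<lambda>p. poly p z"] by simp
    have "poly W z * L =
        poly W z * poly (pderiv (\<phi> (Suc n))) z * eps w \<phi> n z
        + (poly (\<Theta> n) z * eps w \<phi> (Suc n) z - (poly (\<Omega> n) z - poly D z / 2) * eps w \<phi> n z)
          * poly (\<phi> (Suc n)) z
        - (poly W z * poly (pderiv (\<phi> n)) z * eps w \<phi> (Suc n) z
        + (poly (\<Theta> (Suc n)) z * eps w \<phi> (Suc (Suc n)) z
          - (poly (\<Omega> (Suc n)) z - poly D z / 2) * eps w \<phi> (Suc n) z) * poly (\<phi> n) z)"
    proof -
      have "a * (x + p / a * y - (x' + q / a * y')) = a * x + p * y - (a * x' + q * y')"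
        if "a \<noteq> 0" for a x p y x' q y' :: complex
        using that by (simp add: field_simps)
      then show ?thesis
        unfolding L_def using z(2) by (simp add: mult.assoc)
    qed
    also have "\<dots> = (poly (recurrence_factor n) z * poly (\<Theta> (Suc n)) z
        - (poly (\<Omega> (Suc n)) z + poly (\<Omega> n) z)) * X z"
      unfolding pd phi2 eps2[OF z(1)] X_def by (simp add: algebra_simps)
    finally show "poly (Polynomial.smult (of_nat n) W1) z =
        poly (recurrence_factor n * \<Theta> (Suc n) - (\<Omega> (Suc n) + \<Omega> n)) z"
      using 1 X[OF z(1)] C z(3) by (simp add: mult.commute)
  qed
  then show ?thesis .
qed

text \<open>At a root x of W other than 0 the equations of two consecutive levels become linear
  relations between \<open>\<phi> n\<close> and \<open>\<phi> (Suc n)\<close> at x, which are not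
  both zero. It matters that d is the same for every root: comparing roots later eliminates
  it.\<close>

lemma Omega_squared_at_root:
  assumes W: "W = pCons 0 W1"
  obtains d where "\<And>x. x \<noteq> 0 \<Longrightarrow> poly W x = 0 \<Longrightarrow>
    (poly (\<Omega> n) x + poly D x / 2) * (poly (\<Omega> n) x - poly D x / 2) =
      d * x * (poly (\<Theta> n) x * poly (\<Theta> (Suc n)) x)"
proof -
  obtain d where
    phi2: "\<And>z. poly (\<phi> (Suc (Suc n))) z =
      poly (recurrence_factor n) z * poly (\<phi> (Suc n)) z - d * z * poly (\<phi> n) z"
    using three_term_system[of n] by metis
  have "(poly (\<Omega> n) x + poly D x / 2) * (poly (\<Omega> n) x - poly D x / 2) =
      d * x * (poly (\<Theta> n) x * poly (\<Theta> (Suc n)) x)" if x: "x \<noteq> 0" "poly W x = 0" for x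
  proof -
    define V where "V = poly D x / 2"
    have pd: "poly (\<Theta> m) x * poly (\<phi> (Suc m)) x = (poly (\<Omega> m) x + V) * poly (\<phi> m) x" for m
      using arg_cong[OF pderiv_phi[of m], of "\<lambda>p. poly p x"] x by (simp add: V_def)
    \<comment> \<open>As W = z W1 and x is nonzero, \<open>Omega_add\<close> loses its left side at
      x and allows \<Omega> of the next level to be eliminated.\<close>
    have "poly W1 x = 0" using x W by simp
    then have O: "poly (recurrence_factor n) x * poly (\<Theta> (Suc n)) x = poly (\<Omega> (Suc n)) x + poly (\<Omega> n) x"
      using arg_cong[OF Omega_add[OF W, of n], of "\<lambda>p. poly p x"] by simp
    have "poly (recurrence_factor n) x * poly (\<Theta> (Suc n)) x * poly (\<phi> (Suc n)) x
        - d * x * poly (\<Theta> (Suc n)) x * poly (\<phi> n) x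
      = (poly (\<Omega> (Suc n)) x + V) * poly (\<phi> (Suc n)) x"
      unfolding pd[of "Suc n", symmetric] phi2 by (simp add: algebra_simps)
    then have 2: "(poly (\<Omega> n) x - V) * poly (\<phi> (Suc n)) x =
        d * x * poly (\<Theta> (Suc n)) x * poly (\<phi> n) x"
      unfolding O by (simp add: algebra_simps)
    show ?thesis
    proof (cases "poly (\<phi> n) x = 0")
      \<comment> \<open>Here \<open>\<phi> (Suc n)\<close> is nonzero at x, which forces \<Theta>
        and one of the factors on the left to vanish there.\<close>
      case True
      with phi_no_common_root[OF x(1), of n] pd[of n] 2 show ?thesis
        by (simp add: V_def)
    next
      case False
      have "(poly (\<Omega> n) x + V) * (poly (\<Omega> n) x - V) * poly (\<phi> n) x =
          poly (\<Theta> n) x * ((poly (\<Omega> n) x - V) * poly (\<phi> (Suc n)) x)"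
        using pd[of n] by (simp add: algebra_simps)
      also have "\<dots> = d * x * (poly (\<Theta> n) x * poly (\<Theta> (Suc n)) x) * poly (\<phi> n) x"
        unfolding 2 by simp
      finally show ?thesis
        using False by (simp add: V_def)
    qed
  qed
  then show thesis by (rule that)
qed

section \<open>Spectral coefficients at the origin\<close>

lemma inner_equation:
  assumes W: "W = pCons 0 W1" and z: "norm z < 1" "poly W z \<noteq> 0"
  shows "poly W1 z * (of_nat n * inner_part n z + z * deriv (inner_part n) z) =
    poly (\<Theta> n) z * z * inner_part (Suc n) z - (poly (\<Omega> n) z - poly D z / 2) * inner_part n z"
proof -
  have z0: "z \<noteq> 0" "poly W1 z \<noteq> 0" using z W by auto
  have n1: "norm z \<noteq> 1" using z by simp
  define L where "L = (poly (\<Theta> n) z * eps w \<phi> (Suc n) z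
    - (poly (\<Omega> n) z - poly D z / 2) * eps w \<phi> n z) / poly W z"
  have "(eps w \<phi> n has_field_derivative L) (at z)"
    unfolding L_def by (rule deriv_eps[OF n1 z(2)])
  \<comment> \<open>With \<open>eps\<close> replaced by 2 u^n \<open>inner_part\<close>, the factor
    2 z^n can be cancelled from the derivative equation. The resulting terms are continuous at 0, so
    the limit there is available.\<close>
  then have "((\<lambda>u. 2 * u ^ n * inner_part n u) has_field_derivative L) (at z)"
    by (rule has_field_derivative_transform_within_open[where S = "ball 0 1"])
      (use z eps_inner in auto)
  moreover have "(inner_part n has_field_derivative deriv (inner_part n) z) (at z)"
    using holomorphic_derivI[OF holomorphic_inner_part open_ball] z by simp
  then have "((\<lambda>u. 2 * u ^ n * inner_part n u) has_field_derivative
      2 * (of_nat n * z ^ (n - 1)) * inner_part n z + 2 * z ^ n * deriv (inner_part n) z) (at z)"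
    by (auto intro!: derivative_eq_intros)
  ultimately have
    "L = 2 * (of_nat n * z ^ (n - 1)) * inner_part n z + 2 * z ^ n * deriv (inner_part n) z"
    by (rule DERIV_unique)
  then have "z * L = 2 * z ^ n * (of_nat n * inner_part n z + z * deriv (inner_part n) z)"
    by (cases n) (simp_all add: algebra_simps)
  moreover have "poly W1 z * (z * L) = poly (\<Theta> n) z * eps w \<phi> (Suc n) z
    - (poly (\<Omega> n) z - poly D z / 2) * eps w \<phi> n z"
    using z0 by (simp add: L_def W)
  moreover have "\<dots> = 2 * z ^ n * (poly (\<Theta> n) z * z * inner_part (Suc n) z
      - (poly (\<Omega> n) z - poly D z / 2) * inner_part n z)"
    unfolding eps_inner[OF z(1)] by (simp add: algebra_simps)
  ultimately have "2 * z ^ n * (poly W1 z * (of_nat n * inner_part n z + z * deriv (inner_part n) z)) =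
      2 * z ^ n * (poly (\<Theta> n) z * z * inner_part (Suc n) z
      - (poly (\<Omega> n) z - poly D z / 2) * inner_part n z)"
    by simp
  then show ?thesis
    using z0 by simp
qed

lemma eventually_W_nonzero:
  assumes W: "W = pCons 0 W1" "poly W1 0 \<noteq> 0"
  shows "\<forall>\<^sub>F z in at 0. norm z < 1 \<and> poly W z \<noteq> 0"
proof -
  have "\<forall>\<^sub>F z in at 0. poly W1 z \<noteq> 0"
    using W(2) by (intro tendsto_imp_eventually_ne[OF poly_isCont[unfolded isCont_def]])
  moreover have "\<forall>\<^sub>F z in at (0::complex). z \<noteq> 0"
    by (rule eventually_neq_at_within)
  moreover have "\<forall>\<^sub>F z in at (0::complex). norm z < 1"
    by (auto simp: eventually_at intro!: exI[of _ 1])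
  ultimately show ?thesis
    by eventually_elim (simp add: W)
qed

lemma isCont_inner_part: "isCont (inner_part n) 0" "isCont (deriv (inner_part n)) 0"
  using holomorphic_on_imp_continuous_on[OF holomorphic_inner_part[of n]]
    holomorphic_on_imp_continuous_on[OF holomorphic_deriv[OF holomorphic_inner_part[of n]]]
  by (auto simp: continuous_on_eq_continuous_at)

text \<open>The limit of \<open>inner_equation\<close> at 0, where \<open>inner_part\<close> is
  nonzero. Since W(0) = 0, the equation is known only on a punctured neighbourhood and is extended
  by continuity.\<close>

lemma Omega_at_0:
  assumes W: "W = pCons 0 W1" "poly W1 0 \<noteq> 0"
  shows "poly (\<Omega> n) 0 = poly D 0 / 2 - of_nat n * poly W1 0"
proof -
  define f where "f z = poly W1 z * (of_nat n * inner_part n z + z * deriv (inner_part n) z)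
    - (poly (\<Theta> n) z * z * inner_part (Suc n) z
      - (poly (\<Omega> n) z - poly D z / 2) * inner_part n z)" for z
  have "f 0 = 0"
  proof (rule isCont_eventually_0[where f = f and a = 0])
    show "isCont f 0"
      unfolding f_def by (intro continuous_intros isCont_inner_part) simp
    show "\<forall>\<^sub>F z in at 0. f z = 0"
      using eventually_W_nonzero[OF W] inner_equation[OF W(1)]
      by (auto simp: f_def elim!: eventually_mono)
  qed
  then show ?thesis
    by (simp add: f_def inner_part_0 field_simps)
qed

lemma Theta_at_0:
  assumes "W = pCons 0 W1"
  shows "poly (\<Theta> n) 0 * poly (\<phi> (Suc n)) 0 =
    (poly (\<Omega> n) 0 + poly D 0 / 2) * poly (\<phi> n) 0"
  using arg_cong[OF pderiv_phi[of n], of "\<lambda>p. poly p 0"] assms by simp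

text \<open>One geometric step writes the function as a constant plus u R(u), whose derivative at 0
  is R(0).\<close>

lemma deriv_inner_part_0: "deriv (inner_part 0) 0 = \<kappa> 0 * fourier w 1"
proof -
  define R where "R = resolvent inverse (\<lambda>\<zeta>. \<kappa> 0 * inverse \<zeta>)"
  have 0: "\<phi> 0 = [:\<kappa> 0:]"
    using degree_phi(1)[of 0] coeff_phi(1)[of 0] by (metis degree_0_id)
  have "R holomorphic_on ball 0 1"
    unfolding R_def by (rule holomorphic_resolvent) (auto intro!: continuous_intros simp: norm_inverse)
  then have "(R has_field_derivative deriv R 0) (at 0)"
    using holomorphic_derivI[OF _ open_ball] by force
  then have "((\<lambda>u. moment (\<lambda>\<zeta>. \<kappa> 0) + u * R u) has_field_derivative R 0) (at 0)"
    by (auto intro!: derivative_eq_intros)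
  then have "(inner_part 0 has_field_derivative R 0) (at 0)"
  proof (rule has_field_derivative_transform_within_open[where S = "ball 0 1"])
    fix u :: complex assume "u \<in> ball 0 1"
    then show "moment (\<lambda>\<zeta>. \<kappa> 0) + u * R u = inner_part 0 u"
      unfolding inner_part_def R_def 0
      by (subst resolvent_step) (auto intro!: continuous_intros simp: norm_inverse)
  qed auto
  then have "deriv (inner_part 0) 0 = R 0"
    by (rule DERIV_imp_deriv)
  also have "\<dots> = \<kappa> 0 * fourier w 1"
    by (simp add: R_def resolvent_def moment_cmult fourier_def moment_def power_int_minus)
  finally show ?thesis .
qed

text \<open>At level 0, constancy of \<open>\<phi> 0\<close> eliminates \<open>\<Omega> 0\<close>
  and the Casoratian eliminates \<open>inner_part 1\<close>. What remains is k
  \<open>\<Theta> 0\<close> = z W1 G' - D G near 0, whose linear coefficients are compared.\<close>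

lemma Theta_0_coeff_1:
  assumes W: "W = pCons 0 W1" "poly W1 0 \<noteq> 0"
  shows "poly.coeff (\<Theta> 0) 1 * poly (\<phi> 1) 0 =
    \<kappa> 0 * (poly.coeff D 1 + (poly D 0 - poly W1 0) * (\<kappa> 0)\<^sup>2 * fourier w 1)"
proof -
  define G G' where "G = inner_part 0" and "G' = deriv (inner_part 0)"
  have 0: "\<phi> 0 = [:\<kappa> 0:]"
    using degree_phi(1)[of 0] coeff_phi(1)[of 0] by (metis degree_0_id)
  \<comment> \<open>The Casoratian constant at level 0, divided by -2
    \<open>\<kappa> 0\<close>.\<close>
  define k where "k = \<kappa> 1 * first_moment 0 / \<kappa> 0"
  define f where "f z = z * poly W1 z * G' z - poly D z * G z - k * poly (\<Theta> 0) z" for z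
  have ev: "f z = 0" if z: "norm z < 1" "poly W z \<noteq> 0" for z
  proof -
    have "poly (\<Theta> 0) z * poly (\<phi> 1) z = (poly (\<Omega> 0) z + poly D z / 2) * \<kappa> 0"
      using arg_cong[OF pderiv_phi[of 0], of "\<lambda>p. poly p z"] by (simp add: 0)
    then have O: "poly (\<Omega> 0) z - poly D z / 2 = poly (\<Theta> 0) z * poly (\<phi> 1) z / \<kappa> 0 - poly D z"
      by (simp add: field_simps)
    have "norm z \<noteq> 1" using z by simp
    from casoratian[OF reflection this, of 0]
    have "2 * (\<kappa> 1 * first_moment 0) = 2 * (\<kappa> 0 * z * inner_part 1 z - poly (\<phi> 1) z * G z)"
      by (simp add: eps_inner[OF z(1)] 0 G_def algebra_simps)
    then have "\<kappa> 1 * first_moment 0 = \<kappa> 0 * z * inner_part 1 z - poly (\<phi> 1) z * G z"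
      by (rule mult_left_cancel[THEN iffD1, rotated]) simp
    then have k: "k = z * inner_part 1 z - poly (\<phi> 1) z / \<kappa> 0 * G z"
      by (simp add: k_def field_simps)
    have "poly W1 z * (z * G' z) = poly (\<Theta> 0) z * z * inner_part 1 z
        - (poly (\<Theta> 0) z * poly (\<phi> 1) z / \<kappa> 0 - poly D z) * G z"
      using inner_equation[OF W(1) z, of 0] unfolding O by (simp add: G_def G'_def)
    then show ?thesis
      unfolding f_def k by (simp add: algebra_simps)
  qed
  have hol: "G holomorphic_on ball 0 1" "G' holomorphic_on ball 0 1"
    unfolding G_def G'_def
    by (auto intro!: holomorphic_inner_part holomorphic_deriv)
  have dG: "(G has_field_derivative G' 0) (at 0)" "(G' has_field_derivative deriv G' 0) (at 0)"
    using holomorphic_derivI[OF hol(1) open_ball, of 0 UNIV]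
      holomorphic_derivI[OF hol(2) open_ball, of 0 UNIV] by (simp_all add: G_def G'_def)
  have df: "(f has_field_derivative
      poly W1 0 * G' 0 - (poly (pderiv D) 0 * G 0 + poly D 0 * G' 0) - k * poly (pderiv (\<Theta> 0)) 0) (at 0)"
    unfolding f_def by (auto intro!: derivative_eq_intros dG poly_DERIV)
  have "isCont f 0"
    using df DERIV_isCont by blast
  then have f0: "f 0 = 0"
    by (rule isCont_eventually_0[where f = f and a = 0])
      (use eventually_W_nonzero[OF W] ev in \<open>auto elim: eventually_mono\<close>)
  have "((\<lambda>z. 0) has_field_derivative
      poly W1 0 * G' 0 - (poly (pderiv D) 0 * G 0 + poly D 0 * G' 0) - k * poly (pderiv (\<Theta> 0)) 0) (at 0)"
  proof (rule has_field_derivative_transform_within_open[OF df, where S = "ball 0 1 \<inter> {z. poly W1 z \<noteq> 0}"])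
    show "open (ball 0 1 \<inter> {z. poly W1 z \<noteq> 0})"
      by (intro open_Int open_ball open_Collect_neq continuous_intros)
    show "f z = 0" if "z \<in> ball 0 1 \<inter> {z. poly W1 z \<noteq> 0}" for z
      using that ev[of z] f0 by (cases "z = 0") (auto simp: W)
  qed (use W in auto)
  then have "poly W1 0 * G' 0 - (poly (pderiv D) 0 * G 0 + poly D 0 * G' 0)
      - k * poly (pderiv (\<Theta> 0)) 0 = 0"
    using DERIV_const DERIV_unique by blast
  moreover have "poly (pderiv p) 0 = poly.coeff p 1" for p :: "complex poly"
    by (simp add: poly_0_coeff_0 coeff_pderiv)
  moreover have "G 0 = 1 / \<kappa> 0" "G' 0 = \<kappa> 0 * fourier w 1"
    by (simp_all add: G_def G'_def inner_part_0 deriv_inner_part_0)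
  moreover have "k = - poly (\<phi> 1) 0 / (\<kappa> 0)\<^sup>2"
    using phi_Suc_at_0[of 0] by (simp add: k_def power2_eq_square)
  ultimately show ?thesis
    by (simp add: field_simps power2_eq_square)
qed

section \<open>Spectral coefficients at infinity\<close>

lemma degree_euler_derivative: "degree (pCons 0 (pderiv (\<phi> n))) \<le> n"
  by (auto simp: degree_pCons_eq_if degree_pderiv pderiv_eq_0_iff)

lemma coeff_euler_derivative: "poly.coeff (pCons 0 (pderiv (\<phi> n))) n = of_nat n * \<kappa> n"
  by (auto simp: coeff_pCons coeff_pderiv split: nat.splits)

text \<open>Eliminating \<Omega> between the equations for \<phi> and \<epsilon> and inserting the
  Casoratian gives 2 k z^n \<Theta> = W (\<phi> \<epsilon>' - \<phi>' \<epsilon>) - D \<phi>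
  \<epsilon>. The right side is known at infinity through \<open>outer_part\<close>.\<close>

lemma Theta_tendsto:
  assumes W: "degree W \<le> 4" "poly.coeff W 4 = 1" and D: "degree D \<le> 3"
  shows "((\<lambda>z. poly (\<Theta> n) z / z ^ 2) \<longlongrightarrow>
    \<kappa> n / \<kappa> (Suc n) * (of_nat n + 1 + poly.coeff D 3)) at_infinity"
proof -
  define J J' where "J = outer_part n" and "J' = deriv (outer_part n)"
  \<comment> \<open>z \<phi>' has degree at most n for every n, including 0, so no exponent n - 1
    occurs.\<close>
  define q where "q = pCons 0 (pderiv (\<phi> n))"
  define k where "k = \<kappa> (Suc n) * first_moment n"
  have k: "k \<noteq> 0" by (simp add: k_def first_moment_nonzero)
  \<comment> \<open>Grouped into factors that each converge at infinity.\<close>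
  define rhs where "rhs z = (poly W z / z ^ 4) * (poly (\<phi> n) z / z ^ n) * (J (1 / z) + J' (1 / z) * (1 / z))
      + J (1 / z) * (poly W z / z ^ 4) * (poly q z / z ^ n)
      + (poly D z / z ^ 3) * (poly (\<phi> n) z / z ^ n) * J (1 / z)" for z
  have eq: "poly (\<Theta> n) z / z ^ 2 = rhs z / k" if z: "norm z > 1" "poly W z \<noteq> 0" for z
  proof -
    have z1: "norm z \<noteq> 1" and z0: "z \<noteq> 0" using z by auto
    define L where "L = (poly (\<Theta> n) z * eps w \<phi> (Suc n) z
      - (poly (\<Omega> n) z - poly D z / 2) * eps w \<phi> n z) / poly W z"
    have "(eps w \<phi> n has_field_derivative L) (at z)"
      unfolding L_def by (rule deriv_eps[OF z1 z(2)])
    then have "((\<lambda>z. - 2 / z * J (1 / z)) has_field_derivative L) (at z)"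
    proof (rule has_field_derivative_transform_within_open[where S = "- cball 0 1"])
      show "eps w \<phi> n y = - 2 / y * J (1 / y)" if "y \<in> - cball 0 1" for y
        using that eps_outer[of y n] by (simp add: J_def)
    qed (use z in auto)
    moreover have "(J has_field_derivative J' (1 / z)) (at (1 / z))"
      unfolding J_def J'_def
      by (rule holomorphic_derivI[OF holomorphic_outer_part open_ball])
        (use z in \<open>auto simp: norm_divide divide_less_eq_1\<close>)
    then have "((\<lambda>z. - 2 / z * J (1 / z)) has_field_derivative
        2 / z ^ 2 * J (1 / z) + (- 2 / z) * (J' (1 / z) * (- (1 / z ^ 2)))) (at z)"
      using z0 by (auto intro!: derivative_eq_intros DERIV_chain2[where f = J]
          simp: power2_eq_square field_simps)
    ultimately have "L = 2 / z ^ 2 * J (1 / z) + (- 2 / z) * (J' (1 / z) * (- (1 / z ^ 2)))"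
      by (rule DERIV_unique)
    then have L: "L = 2 / z ^ 2 * (J (1 / z) + J' (1 / z) * (1 / z))"
      using z0 by (simp add: field_simps power2_eq_square)
    have e: "eps w \<phi> n z = - 2 / z * J (1 / z)"
      using eps_outer[OF z(1), of n] by (simp add: J_def)
    have pd: "poly W z * poly (pderiv (\<phi> n)) z =
        poly (\<Theta> n) z * poly (\<phi> (Suc n)) z - (poly (\<Omega> n) z + poly D z / 2) * poly (\<phi> n) z"
      using arg_cong[OF pderiv_phi[of n], of "\<lambda>p. poly p z"] by simp
    have WL: "poly W z * L = poly (\<Theta> n) z * eps w \<phi> (Suc n) z
        - (poly (\<Omega> n) z - poly D z / 2) * eps w \<phi> n z"
      using z(2) by (simp add: L_def)
    have "poly W z * L * poly (\<phi> n) z - poly W z * poly (pderiv (\<phi> n)) z * eps w \<phi> n z =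
        - poly (\<Theta> n) z * (poly (\<phi> (Suc n)) z * eps w \<phi> n z - poly (\<phi> n) z * eps w \<phi> (Suc n) z)
        + poly D z * poly (\<phi> n) z * eps w \<phi> n z"
      unfolding pd WL by (simp add: algebra_simps)
    then have *: "poly W z * poly (\<phi> n) z * L - poly W z * poly (pderiv (\<phi> n)) z * eps w \<phi> n z
        - poly D z * poly (\<phi> n) z * eps w \<phi> n z = 2 * k * z ^ n * poly (\<Theta> n) z"
      unfolding casoratian[OF reflection z1] k_def by (simp add: algebra_simps)
    have "rhs z * (2 * z ^ (n + 2)) = 2 * k * z ^ n * poly (\<Theta> n) z"
      unfolding *[symmetric] L e rhs_def q_def using z0
      by (simp add: field_simps power_add eval_nat_numeral)
    then show ?thesis
      using z0 k by (simp add: field_simps power_add power2_eq_square)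
  qed
  have hol: "J holomorphic_on ball 0 1" "J' holomorphic_on ball 0 1"
    unfolding J_def J'_def
    by (auto intro!: holomorphic_outer_part holomorphic_deriv)
  have inv: "((\<lambda>z::complex. 1 / z) \<longlongrightarrow> 0) at_infinity"
    using tendsto_inverse_0 by (simp add: divide_inverse)
  have "isCont J 0" "isCont J' 0"
    using hol[THEN holomorphic_on_imp_continuous_on] by (auto simp: continuous_on_eq_continuous_at)
  note JJ = this[THEN isCont_tendsto_compose, OF inv]
  have q: "degree q \<le> n" "poly.coeff q n = of_nat n * \<kappa> n"
    unfolding q_def by (rule degree_euler_derivative coeff_euler_derivative)+
  have "(rhs \<longlongrightarrow> 1 * \<kappa> n * (first_moment n + J' 0 * 0)
      + first_moment n * 1 * (of_nat n * \<kappa> n) + poly.coeff D 3 * \<kappa> n * first_moment n) at_infinity"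
    unfolding rhs_def
    using tendsto_poly_over_power[OF W(1)] tendsto_poly_over_power[OF D]
      tendsto_poly_over_power[of "\<phi> n" n] tendsto_poly_over_power[OF q(1)] JJ inv
    by (intro tendsto_intros) (simp_all add: W q J_def outer_part_0)
  then have "((\<lambda>z. rhs z / k) \<longlongrightarrow>
      \<kappa> n * first_moment n * (of_nat n + 1 + poly.coeff D 3) / k) at_infinity"
    by (intro tendsto_divide tendsto_const k) (simp add: algebra_simps)
  moreover have "\<forall>\<^sub>F z in at_infinity. rhs z / k = poly (\<Theta> n) z / z ^ 2"
  proof -
    have "\<forall>\<^sub>F z in at_infinity. norm (z :: complex) > 1"
      by (auto simp: eventually_at_infinity intro!: exI[of _ 2])
    moreover have "\<forall>\<^sub>F z in at_infinity. poly W z / z ^ 4 \<noteq> 0"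
      by (rule tendsto_imp_eventually_ne[OF tendsto_poly_over_power[OF W(1)]]) (simp add: W)
    ultimately show ?thesis
      by eventually_elim (auto simp: eq)
  qed
  ultimately have "((\<lambda>z. poly (\<Theta> n) z / z ^ 2) \<longlongrightarrow>
      \<kappa> n * first_moment n * (of_nat n + 1 + poly.coeff D 3) / k) at_infinity"
    by (rule Lim_transform_eventually)
  moreover have "\<kappa> n * first_moment n * (of_nat n + 1 + poly.coeff D 3) / k =
      \<kappa> n / \<kappa> (Suc n) * (of_nat n + 1 + poly.coeff D 3)"
    using first_moment_nonzero[of n] by (simp add: k_def)
  ultimately show ?thesis
    by simp
qed

text \<open>The equation for \<phi>' is solved for \<Omega> + D/2; with the limit of \<Theta> known,
  the terms containing n cancel.\<close>

lemma Omega_tendsto: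
  assumes W: "degree W \<le> 4" "poly.coeff W 4 = 1" and D: "degree D \<le> 3"
  shows "((\<lambda>z. poly (\<Omega> n + Polynomial.smult (1/2) D) z / z ^ 3) \<longlongrightarrow>
    1 + poly.coeff D 3) at_infinity"
proof -
  define q where "q = pCons 0 (pderiv (\<phi> n))"
  have q: "degree q \<le> n" "poly.coeff q n = of_nat n * \<kappa> n"
    unfolding q_def by (rule degree_euler_derivative coeff_euler_derivative)+
  define rhs where "rhs z = ((poly (\<Theta> n) z / z ^ 2) * (poly (\<phi> (Suc n)) z / z ^ Suc n)
    - (poly W z / z ^ 4) * (poly q z / z ^ n)) / (poly (\<phi> n) z / z ^ n)" for z
  have "(rhs \<longlongrightarrow> (\<kappa> n / \<kappa> (Suc n) * (of_nat n + 1 + poly.coeff D 3) * \<kappa> (Suc n)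
      - 1 * (of_nat n * \<kappa> n)) / \<kappa> n) at_infinity"
    unfolding rhs_def
    using Theta_tendsto[OF assms] tendsto_poly_over_power[of "\<phi> (Suc n)" "Suc n"]
      tendsto_poly_over_power[OF W(1)] tendsto_poly_over_power[OF q(1)]
      tendsto_poly_over_power[of "\<phi> n" n]
    by (intro tendsto_intros) (simp_all add: W q)
  moreover have "(\<kappa> n / \<kappa> (Suc n) * (of_nat n + 1 + poly.coeff D 3) * \<kappa> (Suc n)
      - 1 * (of_nat n * \<kappa> n)) / \<kappa> n = 1 + poly.coeff D 3"
    by (simp add: field_simps)
  ultimately have "(rhs \<longlongrightarrow> 1 + poly.coeff D 3) at_infinity"
    by simp
  moreover have "\<forall>\<^sub>F z in at_infinity. poly (\<phi> n) z / z ^ n \<noteq> 0"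
    by (rule tendsto_imp_eventually_ne[OF tendsto_poly_over_power]) simp_all
  with eventually_not_equal_at_infinity[of 0]
  have "\<forall>\<^sub>F z in at_infinity. rhs z = poly (\<Omega> n + Polynomial.smult (1/2) D) z / z ^ 3"
  proof eventually_elim
    case z: (elim z)
    have pd: "poly (\<Omega> n + Polynomial.smult (1/2) D) z * poly (\<phi> n) z =
        poly (\<Theta> n) z * poly (\<phi> (Suc n)) z - poly W z * poly (pderiv (\<phi> n)) z"
      using arg_cong[OF pderiv_phi[of n], of "\<lambda>p. poly p z"] by simp
    have "rhs z = (poly (\<Theta> n) z * poly (\<phi> (Suc n)) z - poly W z * poly (pderiv (\<phi> n)) z)
        / (z ^ 3 * poly (\<phi> n) z)"
      unfolding rhs_def q_def using z by (simp add: field_simps eval_nat_numeral)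
    then show ?case
      unfolding pd[symmetric] using z by simp
  qed
  ultimately show ?thesis
    by (rule Lim_transform_eventually)
qed

end

section \<open>The Garnier recurrences\<close>

lemma poly_degree_le_2:
  fixes p :: "complex poly"
  assumes "degree p \<le> 2"
  shows "p = [:poly.coeff p 0, poly.coeff p 1, poly.coeff p 2:]"
  by (rule poly_eqI)
    (use assms in \<open>auto simp: coeff_pCons coeff_eq_0 numeral_2_eq_2 split: nat.splits\<close>)

lemma poly_degree_le_3:
  fixes p :: "complex poly"
  assumes "degree p \<le> 3"
  shows "p = [:poly.coeff p 0, poly.coeff p 1, poly.coeff p 2, poly.coeff p 3:]"
  by (rule poly_eqI)
    (use assms in \<open>auto simp: coeff_pCons coeff_eq_0 numeral_2_eq_2 numeral_3_eq_3 split: nat.splits\<close>)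

text \<open>By Lagrange interpolation at \<open>1, s, t\<close>, the combinations \<open>s t P\<close>, \<open>R\<close>, \<open>Q\<close> of \<open>f\<close> and \<open>g\<close>
  are the coefficients of \<open>\<theta>\<close> up to one common factor.\<close>

lemma interpolated_coefficients:
  fixes s t f g a C c k \<theta>0 \<theta>1 \<theta>2 :: complex
  defines "P \<equiv> t - s + (1 - t) * f - (1 - s) * g"
    and "Q \<equiv> t - s + (1 - t) * s * f - (1 - s) * t * g"
    and "R \<equiv> s\<^sup>2 - t\<^sup>2 + (1 - s\<^sup>2) * t * g - (1 - t\<^sup>2) * s * f"
  assumes st: "s \<noteq> 0" "t \<noteq> 0" "s \<noteq> t" "s \<noteq> 1" "t \<noteq> 1"
    and f: "s * f * (\<theta>0 + \<theta>1 + \<theta>2) = \<theta>0 + \<theta>1 * s + \<theta>2 * s\<^sup>2"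
    and g: "t * g * (\<theta>0 + \<theta>1 + \<theta>2) = \<theta>0 + \<theta>1 * t + \<theta>2 * t\<^sup>2"
    and nz: "\<theta>0 + \<theta>1 + \<theta>2 \<noteq> 0" "P \<noteq> 0" "Q \<noteq> 0"
    and c: "c * \<theta>0 = a * s * t" and k: "k * \<theta>2 = C"
  shows "k * \<theta>0 + c * \<theta>1 = a * (R / P) + C * s * t * (P / Q)"
    and "k * \<theta>1 + c * \<theta>2 = a * (Q / P) + C * (R / Q)"
proof -
  define T where "T = \<theta>0 + \<theta>1 + \<theta>2"
  \<comment> \<open>Up to sign the Vandermonde determinant of the nodes 1, s, t. Dividing by the
    value T at 1 gives the common factor e relating P, Q, R to the coefficients.\<close>
  define \<Delta> where "\<Delta> = (t - s) * (1 - s) * (1 - t)"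
  have \<Delta>: "\<Delta> \<noteq> 0" using st by (simp add: \<Delta>_def)
  have T: "T \<noteq> 0" using nz by (simp add: T_def)
  define e where "e = \<Delta> / T"
  have e: "e \<noteq> 0" using \<Delta> T by (simp add: e_def)
  have "s * t * P * T = (t - s) * s * t * T + (1 - t) * t * (s * f * T) - (1 - s) * s * (t * g * T)"
    unfolding P_def by (simp add: algebra_simps)
  also have "\<dots> = \<theta>0 * \<Delta>"
    unfolding T_def f g \<Delta>_def by (simp add: algebra_simps power2_eq_square)
  finally have P: "P = \<theta>0 * e / (s * t)" using T st by (simp add: e_def field_simps)
  have "Q * T = (t - s) * T + (1 - t) * (s * f * T) - (1 - s) * (t * g * T)"
    unfolding Q_def by (simp add: algebra_simps)
  also have "\<dots> = \<theta>2 * \<Delta>"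
    unfolding T_def f g \<Delta>_def by (simp add: algebra_simps power2_eq_square)
  finally have Q: "Q = \<theta>2 * e" using T by (simp add: e_def field_simps)
  have "R * T = (s\<^sup>2 - t\<^sup>2) * T + (1 - s\<^sup>2) * (t * g * T) - (1 - t\<^sup>2) * (s * f * T)"
    unfolding R_def by (simp add: algebra_simps)
  also have "\<dots> = \<theta>1 * \<Delta>"
    unfolding T_def f g \<Delta>_def by (simp add: algebra_simps power2_eq_square)
  finally have R: "R = \<theta>1 * e" using T by (simp add: e_def field_simps)
  have \<theta>: "\<theta>0 \<noteq> 0" "\<theta>2 \<noteq> 0" using nz P Q by auto
  have c': "c = a * s * t / \<theta>0" using c \<theta> by (simp add: field_simps)
  show "k * \<theta>0 + c * \<theta>1 = a * (R / P) + C * s * t * (P / Q)"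
    unfolding P Q R k[symmetric] c' using e st \<theta> by (simp add: field_simps)
  show "k * \<theta>1 + c * \<theta>2 = a * (Q / P) + C * (R / Q)"
    unfolding P Q R k[symmetric] c' using e st \<theta> by (simp add: field_simps)
qed

text \<open>Induction on n. The product relations fix f and g at n + 1, since division by s f(n) and
  t g(n) is possible; only then do the sum relations at n + 1, which contain these new values, fix
  the other two sequences.\<close>

lemma garnier_unique:
  assumes f0: "\<And>n. f n \<noteq> 0" "\<And>n. g n \<noteq> 0" and st: "s \<noteq> 0" "t \<noteq> 0"
    and rec: "garnier_recurrences s t \<rho>0 \<rho>s \<rho>t \<rho>1 m0 m1 m2 f g \<omega> varpi"
      "garnier_recurrences s t \<rho>0 \<rho>s \<rho>t \<rho>1 m0 m1 m2 f' g' \<omega>' varpi'"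
    and init: "garnier_initial s t \<rho>0 \<rho>s \<rho>t \<rho>1 m0 wm w0 w1 f g \<omega> varpi"
      "garnier_initial s t \<rho>0 \<rho>s \<rho>t \<rho>1 m0 wm w0 w1 f' g' \<omega>' varpi'"
  shows "f' = f \<and> g' = g \<and> \<omega>' = \<omega> \<and> varpi' = varpi"
proof -
  have "f' n = f n \<and> g' n = g n \<and> \<omega>' n = \<omega> n \<and> varpi' n = varpi n" for n
  proof (induction n)
    case 0
    then show ?case using init unfolding garnier_initial_def by metis
  next
    case (Suc n)
    note r = rec[unfolded garnier_recurrences_def]
    have "s * f' n * f' (n + 1) = s * f n * f (n + 1)"
      using r(1)[THEN conjunct1, rule_format, of n] r(2)[THEN conjunct1, rule_format, of n] Suc
      by simp
    then have f: "f' (Suc n) = f (Suc n)" using Suc f0 st by simp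
    have "t * g' n * g' (n + 1) = t * g n * g (n + 1)"
      using r(1)[THEN conjunct2, THEN conjunct1, rule_format, of n]
        r(2)[THEN conjunct2, THEN conjunct1, rule_format, of n] Suc
      by simp
    then have g: "g' (Suc n) = g (Suc n)" using Suc f0 st by simp
    have "\<omega>' (Suc n) + \<omega>' n = \<omega> (Suc n) + \<omega> n"
      using r(1)[THEN conjunct2, THEN conjunct2, THEN conjunct1, rule_format, of "Suc n"]
        r(2)[THEN conjunct2, THEN conjunct2, THEN conjunct1, rule_format, of "Suc n"] f g
      by simp
    moreover have "varpi' (Suc n) + varpi' n = varpi (Suc n) + varpi n"
      using r(1)[THEN conjunct2, THEN conjunct2, THEN conjunct2, rule_format, of "Suc n"]
        r(2)[THEN conjunct2, THEN conjunct2, THEN conjunct2, rule_format, of "Suc n"] f g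
      by simp
    ultimately show ?case using f g Suc by simp
  qed
  then show ?thesis by auto
qed

section \<open>The polynomials W and 2V for the four singularities\<close>

lemma W_poly_eq: "W_poly s t = pCons 0 [:- (s * t), s + t + s * t, - (1 + s + t), 1:]"
  by (simp add: W_poly_def algebra_simps)

lemma twoV_poly_eq:
  "twoV_poly s t \<rho>0 \<rho>s \<rho>t \<rho>1 =
    [:- (\<rho>0 * s * t), \<rho>0 * (s + t + s * t) + \<rho>1 * s * t + \<rho>s * t + \<rho>t * s,
      - (\<rho>0 * (1 + s + t) + \<rho>s * (1 + t) + \<rho>t * (1 + s) + \<rho>1 * (s + t)), \<rho>0 + \<rho>s + \<rho>t + \<rho>1:]"
  by (simp add: twoV_poly_def algebra_simps)

text \<open>At each singularity only its own exponent survives. These values separate the two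
  factors in each numerator and in the denominator of the product relations.\<close>

lemma poly_twoV_poly:
  "poly (twoV_poly s t \<rho>0 \<rho>s \<rho>t \<rho>1) s = \<rho>s * s * (s - 1) * (s - t)"
  "poly (twoV_poly s t \<rho>0 \<rho>s \<rho>t \<rho>1) t = \<rho>t * t * (t - 1) * (t - s)"
  "poly (twoV_poly s t \<rho>0 \<rho>s \<rho>t \<rho>1) 1 = \<rho>1 * (1 - s) * (1 - t)"
  by (simp_all add: twoV_poly_def algebra_simps)

theorem proposition4p2:
  fixes s t \<rho>0 \<rho>s \<rho>t \<rho>1 m0 m1 m2 m3 :: complex
    and w :: "complex \<Rightarrow> complex"
    and W D :: "complex poly"
    and \<phi> \<phi>b \<Theta> \<Omega> \<Theta>s \<Omega>s :: "nat \<Rightarrow> complex poly"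
    and f g \<omega> varpi :: "nat \<Rightarrow> complex"
  assumes singularities: "distinct [0, s, t, 1]"
    and exponents: "\<rho>0 \<notin> \<nat>" "\<rho>s \<notin> \<nat>" "\<rho>t \<notin> \<nat>" "\<rho>1 \<notin> \<nat>"
    and W: "W = W_poly s t"
    and D: "D = twoV_poly s t \<rho>0 \<rho>s \<rho>t \<rho>1"
    and m: "D = [:- m3, m2, - m1, m0:]"
    and weight: "semiclassical_weight W D w"
    and nondegenerate: "\<And>n. toeplitz_det w n \<noteq> 0"
    and biorthogonal: "biorthogonal_system w \<phi> \<phi>b"
    and spectral: "\<And>n. spectral_coefficients W D w \<phi> \<phi>b n (\<Theta> n) (\<Omega> n) (\<Theta>s n) (\<Omega>s n)"
    and f: "\<And>n. s * f n = poly (\<Theta> n) s / poly (\<Theta> n) 1"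
    and g: "\<And>n. t * g n = poly (\<Theta> n) t / poly (\<Theta> n) 1"
    and \<omega>: "\<And>n. poly.coeff (\<Omega> n) 1 = \<omega> n - m2 / 2"
    and varpi: "\<And>n. poly.coeff (\<Omega> n) 2 = varpi n + m1 / 2"
    \<comment> \<open>genericity\<close>
    and reflection: "\<And>n. poly (\<phi> n) 0 \<noteq> 0" "\<And>n. poly (\<phi>b n) 0 \<noteq> 0"
    and theta: "\<And>n. poly (\<Theta> n) 1 \<noteq> 0" "\<And>n. poly (\<Theta> n) s \<noteq> 0" "\<And>n. poly (\<Theta> n) t \<noteq> 0"
    and denominators:
      "\<And>n. \<omega> n + varpi n + 1 + m0 + (of_nat n - \<rho>0) * s * t + \<rho>1 * (1 - s) * (t - 1) \<noteq> 0"
      "\<And>n. \<omega> n + varpi n + 1 + m0 + (of_nat n - \<rho>0) * s * t \<noteq> 0"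
      "\<And>n. n \<ge> 1 \<Longrightarrow> t - s + (1 - t) * f n - (1 - s) * g n \<noteq> 0"
      "\<And>n. n \<ge> 1 \<Longrightarrow> t - s + (1 - t) * s * f n - (1 - s) * t * g n \<noteq> 0"
    and initial_denominators:
      "fourier w 0 \<noteq> 0" "fourier w (- 1) \<noteq> 0"
      "(1 + m0) * fourier w (- 1)
        - (\<rho>0 * (s + t) + \<rho>1 * s * t + \<rho>s * t + \<rho>t * s) * fourier w 0
        - (1 - \<rho>0) * s * t * fourier w 1 \<noteq> 0"
  shows
    "garnier_recurrences s t \<rho>0 \<rho>s \<rho>t \<rho>1 m0 m1 m2 f g \<omega> varpi \<and>
     garnier_initial s t \<rho>0 \<rho>s \<rho>t \<rho>1 m0 (fourier w (- 1)) (fourier w 0) (fourier w 1) f g \<omega> varpi \<and>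
     (\<forall>f' g' \<omega>' varpi'.
        garnier_recurrences s t \<rho>0 \<rho>s \<rho>t \<rho>1 m0 m1 m2 f' g' \<omega>' varpi' \<and>
        garnier_initial s t \<rho>0 \<rho>s \<rho>t \<rho>1 m0
          (fourier w (- 1)) (fourier w 0) (fourier w 1) f' g' \<omega>' varpi' \<longrightarrow>
        f' = f \<and> g' = g \<and> \<omega>' = \<omega> \<and> varpi' = varpi)"
proof -
  have st: "s \<noteq> 0" "t \<noteq> 0" "s \<noteq> t" "s \<noteq> 1" "t \<noteq> 1"
    using singularities by auto
  define W1 where "W1 = [:- (s * t), s + t + s * t, - (1 + s + t), 1:]"
  have W1: "W = pCons 0 W1" and W1_0: "poly W1 0 \<noteq> 0"
    using st by (simp_all add: W W_poly_eq W1_def)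
  have W_nz: "W \<noteq> 0"
    by (simp add: W1 W1_def)
  interpret spectral_system w \<phi> \<phi>b W D \<Theta> \<Omega> \<Theta>s \<Omega>s
    by unfold_locales
      (use weight biorthogonal spectral reflection W_nz in \<open>auto simp: semiclassical_weight_def\<close>)
  have m2: "m2 = \<rho>0 * (s + t + s * t) + \<rho>1 * s * t + \<rho>s * t + \<rho>t * s"
    and m3: "m3 = \<rho>0 * s * t"
    using D m by (simp_all add: twoV_poly_eq)
  have Dc: "poly.coeff D 0 = - m3" "poly.coeff D 1 = m2" "poly.coeff D 2 = - m1"
      "poly.coeff D 3 = m0" "poly D 0 = - m3"
    by (simp_all add: m numeral_2_eq_2 numeral_3_eq_3)
  have deg: "degree W \<le> 4" "poly.coeff W 4 = 1" "degree D \<le> 3"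
    by (simp_all add: W1 W1_def m eval_nat_numeral)

  \<comment> \<open>Coefficients of the spectral polynomials\<close>
  define \<theta>0 \<theta>1 \<theta>2 where "\<theta>0 n = poly.coeff (\<Theta> n) 0" and "\<theta>1 n = poly.coeff (\<Theta> n) 1"
    and "\<theta>2 n = poly.coeff (\<Theta> n) 2" for n
  note lim = degree_coeff_of_tendsto[OF Theta_tendsto[OF deg]]
  have \<Theta>: "\<Theta> n = [:\<theta>0 n, \<theta>1 n, \<theta>2 n:]" for n
    using poly_degree_le_2[OF lim(1)[of n]] by (simp add: \<theta>0_def \<theta>1_def \<theta>2_def)
  have \<Theta>z: "poly (\<Theta> n) z = \<theta>0 n + \<theta>1 n * z + \<theta>2 n * z\<^sup>2" for n z
    by (simp add: \<Theta> power2_eq_square algebra_simps)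
  have \<theta>2: "\<kappa> (Suc n) / \<kappa> n * \<theta>2 n = of_nat n + 1 + m0" for n
    using lim(2)[of n] by (simp add: \<theta>2_def Dc)
  have \<Omega>0: "poly (\<Omega> n) 0 = of_nat n * s * t - m3 / 2" for n
    using Omega_at_0[OF W1 W1_0, of n] by (simp add: Dc W1_def)
  have \<theta>0: "\<theta>0 n * poly (\<phi> (Suc n)) 0 = (of_nat n - \<rho>0) * s * t * poly (\<phi> n) 0" for n
    using Theta_at_0[OF W1, of n] by (simp add: \<Omega>0 Dc \<Theta>z m3 algebra_simps)
  \<comment> \<open>Adding V cancels the half shifts by the m's, so the middle coefficients are
    exactly \<open>\<omega> n\<close> and \<open>varpi n\<close>.\<close>
  define Psi where "Psi n = \<Omega> n + Polynomial.smult (1/2) D" for n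
  note limO = degree_coeff_of_tendsto[OF Omega_tendsto[OF deg], folded Psi_def]
  have Oeq: "Psi n = [:(of_nat n - \<rho>0) * s * t, \<omega> n, varpi n, 1 + m0:]" for n
  proof -
    have "poly.coeff (Psi n) 0 = (of_nat n - \<rho>0) * s * t"
      using \<Omega>0[of n] by (simp add: Psi_def poly_0_coeff_0 Dc m3 algebra_simps)
    moreover have "poly.coeff (Psi n) 1 = \<omega> n" "poly.coeff (Psi n) 2 = varpi n"
      by (simp_all add: Psi_def \<omega> varpi Dc[unfolded One_nat_def] Dc \<omega>[unfolded One_nat_def])
    ultimately show ?thesis
      using poly_degree_le_3[OF limO(1)[of n]] limO(2)[of n] by (simp add: Dc)
  qed
  have Oz: "poly (\<Omega> n) z + poly D z / 2 =
      (of_nat n - \<rho>0) * s * t + \<omega> n * z + varpi n * z\<^sup>2 + (1 + m0) * z ^ 3" for n z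
    using arg_cong[OF Oeq[of n], of "\<lambda>p. poly p z"]
    by (simp add: Psi_def power2_eq_square power3_eq_cube algebra_simps)
  have Oz': "poly (\<Omega> n) z - poly D z / 2 = (poly (\<Omega> n) z + poly D z / 2) - poly D z" for n z
    by simp
  have f': "poly (\<Theta> n) s = s * f n * poly (\<Theta> n) 1"
    and g': "poly (\<Theta> n) t = t * g n * poly (\<Theta> n) 1" for n
    using f[of n] g[of n] theta(1)[of n] by (simp_all add: field_simps)
  define B where "B n = (\<omega> n + varpi n + 1 + m0 + (of_nat n - \<rho>0) * s * t + \<rho>1 * (1 - s) * (t - 1))
         * (\<omega> n + varpi n + 1 + m0 + (of_nat n - \<rho>0) * s * t)" for n
  have B: "B n \<noteq> 0" for n
    using denominators(1,2)[of n] by (simp add: B_def)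

  \<comment> \<open>Product relations from the singularities 1, s, t\<close>
  have product: "s * f n * f (n + 1) =
      ((\<omega> n + s * varpi n + (1 + m0) * s^2 + (of_nat n - \<rho>0) * t + \<rho>s * (s - t) * (1 - s))
         * (\<omega> n + s * varpi n + (1 + m0) * s^2 + (of_nat n - \<rho>0) * t)) / B n"
    "t * g n * g (n + 1) =
      ((\<omega> n + t * varpi n + (1 + m0) * t^2 + (of_nat n - \<rho>0) * s + \<rho>t * (t - s) * (1 - t))
         * (\<omega> n + t * varpi n + (1 + m0) * t^2 + (of_nat n - \<rho>0) * s)) / B n" for n
  proof -
    obtain d where d: "\<And>x. x \<noteq> 0 \<Longrightarrow> poly W x = 0 \<Longrightarrow>
        (poly (\<Omega> n) x + poly D x / 2) * (poly (\<Omega> n) x - poly D x / 2) =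
          d * x * (poly (\<Theta> n) x * poly (\<Theta> (Suc n)) x)"
      using Omega_squared_at_root[OF W1] by blast
    have roots: "poly W 1 = 0" "poly W s = 0" "poly W t = 0"
      by (simp_all add: W W_poly_def algebra_simps)
    \<comment> \<open>E collects the unknown d and the values of \<Theta> at 1. The relation at 1
      identifies it with \<open>B n\<close>; inserting this at s and t removes d.\<close>
    define E where "E = d * (poly (\<Theta> n) 1 * poly (\<Theta> (Suc n)) 1)"
    have "poly (\<Omega> n) 1 + poly D 1 / 2 = \<omega> n + varpi n + 1 + m0 + (of_nat n - \<rho>0) * s * t"
      unfolding Oz by simp
    moreover have "poly (\<Omega> n) 1 - poly D 1 / 2 =
        \<omega> n + varpi n + 1 + m0 + (of_nat n - \<rho>0) * s * t + \<rho>1 * (1 - s) * (t - 1)"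
      unfolding Oz' Oz unfolding D poly_twoV_poly by (simp add: algebra_simps)
    ultimately have E: "E = B n"
      using d[OF _ roots(1)] by (simp add: E_def B_def mult.commute)
    \<comment> \<open>The constant term of \<Omega> + V contains s t, so at s a factor s splits off
      both \<Omega> + V and \<Omega> - V.\<close>
    define xs ys where
      "xs = \<omega> n + s * varpi n + (1 + m0) * s^2 + (of_nat n - \<rho>0) * t" and
      "ys = \<omega> n + s * varpi n + (1 + m0) * s^2 + (of_nat n - \<rho>0) * t
        + \<rho>s * (s - t) * (1 - s)"
    have "poly (\<Omega> n) s + poly D s / 2 = s * xs"
      unfolding Oz xs_def by (simp add: power2_eq_square power3_eq_cube algebra_simps)
    moreover have "poly (\<Omega> n) s - poly D s / 2 = s * ys"
      unfolding Oz' Oz unfolding D poly_twoV_poly ys_def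
      by (simp add: power2_eq_square power3_eq_cube algebra_simps)
    ultimately have "(s * s) * (ys * xs) =
        (s * s) * (s * f n * f (n + 1) * E)"
      using d[OF st(1) roots(2)] unfolding f' E_def by (simp only: mult_ac Suc_eq_plus1)
    then have "ys * xs =
        s * f n * f (n + 1) * B n"
      unfolding E using st by simp
    then show "s * f n * f (n + 1) =
      ((\<omega> n + s * varpi n + (1 + m0) * s^2 + (of_nat n - \<rho>0) * t + \<rho>s * (s - t) * (1 - s))
         * (\<omega> n + s * varpi n + (1 + m0) * s^2 + (of_nat n - \<rho>0) * t)) / B n"
      unfolding xs_def ys_def by (simp only: nonzero_eq_divide_eq[OF B])
    define xt yt where
      "xt = \<omega> n + t * varpi n + (1 + m0) * t^2 + (of_nat n - \<rho>0) * s" and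
      "yt = \<omega> n + t * varpi n + (1 + m0) * t^2 + (of_nat n - \<rho>0) * s
        + \<rho>t * (t - s) * (1 - t)"
    have "poly (\<Omega> n) t + poly D t / 2 = t * xt"
      unfolding Oz xt_def by (simp add: power2_eq_square power3_eq_cube algebra_simps)
    moreover have "poly (\<Omega> n) t - poly D t / 2 = t * yt"
      unfolding Oz' Oz unfolding D poly_twoV_poly yt_def
      by (simp add: power2_eq_square power3_eq_cube algebra_simps)
    ultimately have "(t * t) * (yt * xt) =
        (t * t) * (t * g n * g (n + 1) * E)"
      using d[OF st(2) roots(3)] unfolding g' E_def by (simp only: mult_ac Suc_eq_plus1)
    then have "yt * xt =
        t * g n * g (n + 1) * B n"
      unfolding E using st by simp
    then show "t * g n * g (n + 1) =
      ((\<omega> n + t * varpi n + (1 + m0) * t^2 + (of_nat n - \<rho>0) * s + \<rho>t * (t - s) * (1 - t))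
         * (\<omega> n + t * varpi n + (1 + m0) * t^2 + (of_nat n - \<rho>0) * s)) / B n"
      unfolding xt_def yt_def by (simp only: nonzero_eq_divide_eq[OF B])
  qed

  \<comment> \<open>Sum relations from the Casoratian identity\<close>
  have sums: "\<omega> n + \<omega> (n - 1) =
      m2 - (of_nat n - 1) * (s + t + s * t)
      + (of_nat n - \<rho>0) *
          ((s^2 - t^2 + (1 - s^2) * t * g n - (1 - t^2) * s * f n)
           / (t - s + (1 - t) * f n - (1 - s) * g n))
      + (of_nat n + 1 + m0) * s * t *
          ((t - s + (1 - t) * f n - (1 - s) * g n)
           / (t - s + (1 - t) * s * f n - (1 - s) * t * g n))"
    "varpi n + varpi (n - 1) =
      - m1 + (of_nat n - 1) * (1 + s + t)
      + (of_nat n - \<rho>0) *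
          ((t - s + (1 - t) * s * f n - (1 - s) * t * g n)
           / (t - s + (1 - t) * f n - (1 - s) * g n))
      + (of_nat n + 1 + m0) *
          ((s^2 - t^2 + (1 - s^2) * t * g n - (1 - t^2) * s * f n)
           / (t - s + (1 - t) * s * f n - (1 - s) * t * g n))" if n: "n \<ge> 1" for n
  proof -
    \<comment> \<open>\<open>Omega_add\<close> is applied at level j = n - 1; this is the source of
      the factors n - 1.\<close>
    obtain j where j: "n = Suc j" using n by (cases n) auto
    define c k where "c = poly (\<phi> (Suc n)) 0 / poly (\<phi> n) 0" and "k = \<kappa> (Suc n) / \<kappa> n"
    have "Polynomial.smult (of_nat j) W1 = [:c, k:] * \<Theta> n - (\<Omega> n + \<Omega> j)"
      using Omega_add[OF W1, of j] by (simp add: recurrence_factor_def c_def k_def j)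
    from arg_cong[OF this, of "\<lambda>p. poly.coeff p 1"] arg_cong[OF this, of "\<lambda>p. poly.coeff p 2"]
    have add: "of_nat j * (s + t + s * t) = k * \<theta>0 n + c * \<theta>1 n - (\<omega> n + \<omega> j - m2)"
      "- of_nat j * (1 + s + t) = k * \<theta>1 n + c * \<theta>2 n - (varpi n + varpi j + m1)"
      by (simp_all add: W1_def \<Theta> varpi \<omega>[unfolded One_nat_def] numeral_2_eq_2 varpi[unfolded numeral_2_eq_2]
          algebra_simps)
    \<comment> \<open>This and the leading coefficient of \<Theta> supply the normalisation that the
      ratios f and g lose.\<close>
    have c: "c * \<theta>0 n = (of_nat n - \<rho>0) * s * t"
      using \<theta>0[of n] reflection(1)[of n] by (simp add: c_def field_simps)
    have f1: "s * f n * (\<theta>0 n + \<theta>1 n + \<theta>2 n) = \<theta>0 n + \<theta>1 n * s + \<theta>2 n * s\<^sup>2"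
      and g1: "t * g n * (\<theta>0 n + \<theta>1 n + \<theta>2 n) = \<theta>0 n + \<theta>1 n * t + \<theta>2 n * t\<^sup>2"
      using f'[of n] g'[of n] by (simp_all add: \<Theta>z)
    have nz: "\<theta>0 n + \<theta>1 n + \<theta>2 n \<noteq> 0"
      using theta(1)[of n] by (simp add: \<Theta>z)
    note coeffs = interpolated_coefficients[OF st f1 g1 nz denominators(3)[OF n] denominators(4)[OF n]
        c \<theta>2[of n, folded k_def]]
    have jn: "of_nat n - 1 = (of_nat j :: complex)" "n - 1 = j" by (simp_all add: j)
    have "\<omega> n + \<omega> j = m2 - of_nat j * (s + t + s * t) + (k * \<theta>0 n + c * \<theta>1 n)"
      using add(1) by (simp add: algebra_simps)
    also note coeffs(1)
    finally show "\<omega> n + \<omega> (n - 1) =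
      m2 - (of_nat n - 1) * (s + t + s * t)
      + (of_nat n - \<rho>0) *
          ((s^2 - t^2 + (1 - s^2) * t * g n - (1 - t^2) * s * f n)
           / (t - s + (1 - t) * f n - (1 - s) * g n))
      + (of_nat n + 1 + m0) * s * t *
          ((t - s + (1 - t) * f n - (1 - s) * g n)
           / (t - s + (1 - t) * s * f n - (1 - s) * t * g n))"
      unfolding jn by (simp only: add.assoc)
    have "varpi n + varpi j = - m1 + of_nat j * (1 + s + t) + (k * \<theta>1 n + c * \<theta>2 n)"
      using add(2) by (simp add: algebra_simps)
    also note coeffs(2)
    finally show "varpi n + varpi (n - 1) =
      - m1 + (of_nat n - 1) * (1 + s + t)
      + (of_nat n - \<rho>0) *
          ((t - s + (1 - t) * s * f n - (1 - s) * t * g n)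
           / (t - s + (1 - t) * f n - (1 - s) * g n))
      + (of_nat n + 1 + m0) *
          ((s^2 - t^2 + (1 - s^2) * t * g n - (1 - t^2) * s * f n)
           / (t - s + (1 - t) * s * f n - (1 - s) * t * g n))"
      unfolding jn by (simp only: add.assoc)
  qed
  have rec: "garnier_recurrences s t \<rho>0 \<rho>s \<rho>t \<rho>1 m0 m1 m2 f g \<omega> varpi"
    unfolding garnier_recurrences_def using product[unfolded B_def] sums by blast

  \<comment> \<open>Initial values\<close>
  define wm w0 w1 where "wm = fourier w (- 1)" and "w0 = fourier w 0" and "w1 = fourier w 1"
  have w_nz: "wm \<noteq> 0" "w0 \<noteq> 0"
    using initial_denominators by (simp_all add: wm_def w0_def)
  define p where "p = poly (\<phi> 1) 0"
  have p_nz: "p \<noteq> 0" using reflection by (simp add: p_def)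
  have phi0: "\<phi> 0 = [:\<kappa> 0:]" "\<phi>b 0 = [:\<kappa> 0:]"
    using degree_phi[of 0] coeff_phi[of 0] by (metis degree_0_id)+
  have norm0: "(\<kappa> 0)\<^sup>2 * w0 = 1"
  proof -
    have "1 = pairing (\<phi> 0) (\<phi>b 0)" by (simp add: pairing_phi)
    also have "\<dots> = (\<kappa> 0)\<^sup>2 * moment (\<lambda>\<zeta>. 1)"
      using moment_cmult[of "(\<kappa> 0)\<^sup>2" "\<lambda>\<zeta>. 1"] by (simp add: pairing_def phi0 power2_eq_square)
    also have "moment (\<lambda>\<zeta>. 1) = w0"
      by (simp add: moment_def w0_def fourier_def)
    finally show ?thesis by simp
  qed
  have "first_moment 0 = \<kappa> 0 * wm"
    using moment_cmult[of "\<kappa> 0" "\<lambda>\<zeta>. \<zeta>"]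
    by (simp add: first_moment_def phi0 wm_def fourier_def moment_def mult.commute)
  then have p: "p = - \<kappa> 1 * wm / w0"
    using phi_Suc_at_0[of 0] norm0 w_nz by (simp add: p_def field_simps power2_eq_square)
  have phi1: "\<phi> 1 = [:p, \<kappa> 1:]"
    using degree_phi(1)[of 1] coeff_phi(1)[of 1]
    by (intro poly_eqI) (auto simp: coeff_pCons coeff_eq_0 p_def poly_0_coeff_0 split: nat.splits)
  have \<theta>1_0: "\<theta>1 0 * p = \<kappa> 0 * (m2 + (1 - \<rho>0) * s * t * (w1 / w0))"
  proof -
    have "\<theta>1 0 * p = \<kappa> 0 * (m2 + (s * t - m3) * (\<kappa> 0)\<^sup>2 * w1)"
      using Theta_0_coeff_1[OF W1 W1_0] by (simp add: \<theta>1_def p_def Dc Dc(2)[unfolded One_nat_def] w1_def W1_def)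
    also have "(\<kappa> 0)\<^sup>2 = 1 / w0" using norm0 w_nz by (simp add: field_simps)
    finally show ?thesis by (simp add: m3 algebra_simps)
  qed
  have \<theta>0_0: "\<theta>0 0 * p = - (\<rho>0 * s * t * \<kappa> 0)"
    using \<theta>0[of 0] by (simp add: p_def phi0)
  have \<theta>2_0: "\<theta>2 0 * p = - (\<kappa> 0 * (1 + m0) * wm / w0)"
    using \<theta>2[of 0] by (simp add: p field_simps)
  have init: "garnier_initial s t \<rho>0 \<rho>s \<rho>t \<rho>1 m0 wm w0 w1 f g \<omega> varpi"
  proof -
    \<comment> \<open>A multiple of \<open>\<Theta> 0\<close> with coefficients in the three
      Toeplitz elements; the factor drops out of the ratios defining f and g.\<close>
    define q where "q z = \<rho>0 * s * t * w0 - (m2 * w0 + (1 - \<rho>0) * s * t * w1) * z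
      + (1 + m0) * wm * z\<^sup>2" for z
    have q: "poly (\<Theta> 0) z * (p * w0) = - \<kappa> 0 * q z" for z
    proof -
      have "poly (\<Theta> 0) z * (p * w0) =
          w0 * (\<theta>0 0 * p + (\<theta>1 0 * p) * z + (\<theta>2 0 * p) * z\<^sup>2)"
        by (simp add: \<Theta>z algebra_simps)
      also have "\<dots> = - \<kappa> 0 * q z"
        unfolding \<theta>0_0 \<theta>1_0 \<theta>2_0 q_def using w_nz by (simp add: field_simps)
      finally show ?thesis .
    qed
    have q1: "q 1 \<noteq> 0"
      using q[of 1] theta(1)[of 0] p_nz w_nz by auto
    have "s * f 0 * q 1 = q s" "t * g 0 * q 1 = q t"
    proof -
      have "\<kappa> 0 * (s * f 0 * q 1) = - (s * f 0 * (poly (\<Theta> 0) 1 * (p * w0)))"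
        unfolding q by simp
      also have "\<dots> = \<kappa> 0 * q s"
        using q[of s] unfolding f' by (simp add: mult_ac)
      finally show "s * f 0 * q 1 = q s" by simp
      have "\<kappa> 0 * (t * g 0 * q 1) = - (t * g 0 * (poly (\<Theta> 0) 1 * (p * w0)))"
        unfolding q by simp
      also have "\<dots> = \<kappa> 0 * q t"
        using q[of t] unfolding g' by (simp add: mult_ac)
      finally show "t * g 0 * q 1 = q t" by simp
    qed
    then have fg: "f 0 = (q s / s) / q 1" "g 0 = (q t / t) / q 1"
      using st q1 by (simp_all add: field_simps)
    have "q s / s = (1 + m0) * s * wm
        - (\<rho>0 * s * (t + 1) + \<rho>1 * s * t + \<rho>s * t + \<rho>t * s) * w0 - (1 - \<rho>0) * s * t * w1"
      "q t / t = (1 + m0) * t * wm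
        - (\<rho>0 * t * (s + 1) + \<rho>1 * s * t + \<rho>s * t + \<rho>t * s) * w0 - (1 - \<rho>0) * s * t * w1"
      "q 1 = (1 + m0) * wm
        - (\<rho>0 * (s + t) + \<rho>1 * s * t + \<rho>s * t + \<rho>t * s) * w0 - (1 - \<rho>0) * s * t * w1"
      using st by (simp_all add: q_def m2 field_simps power2_eq_square)
    note fg = fg[unfolded this]
    \<comment> \<open>The derivative of \<open>\<phi> 0\<close> vanishes, so this is an exact
      factorisation, whose coefficients at z and z^2 give the remaining two initial values.\<close>
    have "Psi 0 * [:\<kappa> 0:] = \<Theta> 0 * \<phi> 1"
      using pderiv_phi[of 0] by (simp add: Psi_def phi0)
    then have e: "\<kappa> 0 * \<omega> 0 = \<theta>1 0 * p + \<theta>0 0 * \<kappa> 1"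
        "\<kappa> 0 * varpi 0 = \<theta>2 0 * p + \<theta>1 0 * \<kappa> 1"
      unfolding Oeq \<Theta> phi1 by (simp_all add: algebra_simps)
    have "\<kappa> 1 = - (w0 / wm) * p"
      using w_nz by (simp add: p)
    then have "\<kappa> 0 * \<omega> 0 = \<theta>1 0 * p - (w0 / wm) * (\<theta>0 0 * p)"
      "\<kappa> 0 * varpi 0 = \<theta>2 0 * p - (w0 / wm) * (\<theta>1 0 * p)"
      unfolding e by (simp_all add: algebra_simps)
    then have "\<kappa> 0 * \<omega> 0 = \<kappa> 0 * (m2 + (1 - \<rho>0) * s * t * (w1 / w0) + \<rho>0 * s * t * (w0 / wm))"
      "\<kappa> 0 * varpi 0 = \<kappa> 0 * (- (1 + m0) * (wm / w0)
        - (m2 * (w0 / wm) + (1 - \<rho>0) * s * t * ((w1 / w0) * (w0 / wm))))"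
      unfolding \<theta>0_0 \<theta>1_0 \<theta>2_0 using w_nz by (simp_all add: algebra_simps add_divide_distrib)
    then have "\<omega> 0 = m2 + (1 - \<rho>0) * s * t * (w1 / w0) + \<rho>0 * s * t * (w0 / wm)"
      "varpi 0 = - (1 + m0) * (wm / w0) - (m2 * (w0 / wm) + (1 - \<rho>0) * s * t * (w1 / wm))"
      using w_nz by simp_all
    with fg show ?thesis
      unfolding garnier_initial_def by (simp add: m2 algebra_simps)
  qed

  \<comment> \<open>Unique determination by the recurrences\<close>
  have "f n \<noteq> 0" "g n \<noteq> 0" for n
    using f'[of n] g'[of n] theta[of n] by auto
  then show ?thesis
    using rec init garnier_unique[OF _ _ st(1,2) rec _ init]
    unfolding wm_def w0_def w1_def by blast
qed

end
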